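(* Let $m$ be an even positive integer, let $\tilde H\in\Omega_{4n}$ be invertible and Hermitian, and let $\tilde B\in\Omega_{4n}$ be $\tilde H$-selfadjoint with $\sigma(\tilde B)\subset(-\infty,0)$. Then there exists an $\tilde H$-selfadjoint $\tilde A\in\Omega_{4n}$ with $\tilde A^m=\tilde B$ if and only if there exist an invertible $S\in\Omega_{4n}$, an integer $t$, integers $k_j\ge1$ and numbers $\lambda_j<0$ ($j=1,\dots,t$) such that $$S^{-1}\tilde BS=\bigoplus_{j=1}^t\big(J_{k_j}(\lambda_j)\oplus J_{k_j}(\lambda_j)\big)\oplus\bigoplus_{j=1}^t\big(J_{k_j}(\lambda_j)\oplus J_{k_j}(\lambda_j)\big),$$ $$S^*\tilde HS=\bigoplus_{j=1}^t\big(Q_{k_j}\oplus -Q_{k_j}\big)\oplus\bigoplus_{j=1}^t\big(Q_{k_j}\oplus -Q_{k_j}\big).$$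
   Context: $\Omega_{2k}=\{\begin{bmatrix}A_1&\bar A_2\\-A_2&\bar A_1\end{bmatrix}: A_1,A_2\in\mathbb{C}^{k\times k}\}\subset\mathbb{C}^{2k\times 2k}$. $J_k(\lambda)$: $k\times k$ upper triangular Jordan block with eigenvalue $\lambda$; $Q_k$: $k\times k$ matrix with ones on the main anti-diagonal and zeros elsewhere; $\oplus$: block diagonal sum. For invertible Hermitian $H$, $A$ is $H$-selfadjoint if $HA=A^*H$. *)

theory Defs
  imports "Jordan_Normal_Form.Jordan_Normal_Form" "Jordan_Normal_Form.Schur_Decomposition"
begin

text \<open>The set Omega_{2k} of complex 2k x 2k matrices of block form
  [A1, conj A2; -A2, conj A1] with A1, A2 complex k x k matrices.\<close>
definition Omega :: "nat \<Rightarrow> complex mat set" where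
  "Omega k = {four_block_mat A1 (map_mat cnj A2) (- A2) (map_mat cnj A1) | A1 A2.
                A1 \<in> carrier_mat k k \<and> A2 \<in> carrier_mat k k}"

definition Q_mat :: "nat \<Rightarrow> complex mat" where
  "Q_mat k = mat k k (\<lambda>(i,j). if i + j = k - 1 then 1 else 0)"

definition hermitian_mat :: "complex mat \<Rightarrow> bool" where
  "hermitian_mat H \<longleftrightarrow> square_mat H \<and> mat_adjoint H = H"

definition H_selfadjoint :: "complex mat \<Rightarrow> complex mat \<Rightarrow> bool" where
  "H_selfadjoint H A \<longleftrightarrow> H * A = mat_adjoint A * H"

definition spectrum_mat :: "complex mat \<Rightarrow> complex set" where
  "spectrum_mat A = {e. eigenvalue A e}"

definition inv_mat :: "complex mat \<Rightarrow> complex mat" where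
  "inv_mat S = (THE T. inverts_mat S T \<and> inverts_mat T S)"

definition jordan_part :: "(nat \<times> real) list \<Rightarrow> complex mat list" where
  "jordan_part ps = concat (map (\<lambda>(k,l). [jordan_block k (complex_of_real l),
                                           jordan_block k (complex_of_real l)]) ps)"

definition Q_part :: "(nat \<times> real) list \<Rightarrow> complex mat list" where
  "Q_part ps = concat (map (\<lambda>(k,l). [Q_mat k, - Q_mat k]) ps)"

end

theory Submission
  imports Defs "HOL-Computational_Algebra.Formal_Power_Series"
begin

text \<open>
  Both sides are equivalent to the existence of a complex structure, that is, of a selfadjoint \<open>K\<close> in
  \<open>Omega\<close> that commutes with \<open>B\<close> and satisfies \<open>K\<^sup>2 = -1\<close>. Since the spectrum of \<open>B\<close> is negative, real
  polynomials in \<open>B\<close> provide roots \<open>R\<close> of \<open>-B\<close> of every order, and a square root \<open>R\<close> of the inverse of \<open>-B\<close>.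
  With the latter, a root \<open>A\<close> of \<open>B\<close> gives \<open>K = R * A^(m/2)\<close>; conversely, if \<open>R^m = -B\<close>, then
  \<open>R * (cos (pi/m) + sin (pi/m) * K)\<close> is an \<open>m\<close>-th root of \<open>B\<close>. For the canonical form, \<open>K\<close> is \<open>\<i>\<close> times the
  interchange of the two Jordan blocks of each pair, and its complex conjugate on the second copy.

  Given \<open>K\<close>, let \<open>J\<close> be the quaternionic structure and \<open>h\<close> the form defined by \<open>H\<close>. The eigenspace of \<open>K\<close>
  for \<open>\<i>\<close> is totally isotropic, and \<open>\<omega> x y = h (J x) y\<close> is a symplectic form on it for which \<open>B\<close> is
  selfadjoint; hence Jordan chains of \<open>B\<close> in this eigenspace are isotropic for \<open>\<omega>\<close> and come in dual pairs
  \<open>e\<close>, \<open>f\<close>. The chains of \<open>e - Jf/2\<close> and \<open>e + Jf/2\<close> then have the Gram matrices \<open>Q\<close> and \<open>-Q\<close>. A maximal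
  family of such pairs exhausts the space, because its orthogonal complement is again invariant under
  \<open>B\<close>, \<open>K\<close> and \<open>J\<close>.
\<close>

section \<open>Polynomials and power series\<close>

lemma power_shift_factor:
  fixes p q r f g c :: "'a :: comm_ring_1"
  assumes "p ^ m * g - f = q * r"
  shows "(p + c * q) ^ m * g - f = q * (r + c * (\<Sum>i<m. p ^ (m - Suc i) * (p + c * q) ^ i) * g)"
proof -
  have "(p + c * q) ^ m - p ^ m = c * q * (\<Sum>i<m. p ^ (m - Suc i) * (p + c * q) ^ i)"
    unfolding power_diff_sumr2 by simp
  moreover have "(p + c * q) ^ m * g - f = (p ^ m * g - f) + ((p + c * q) ^ m - p ^ m) * g"
    by (simp add: algebra_simps)
  ultimately show ?thesis unfolding assms by (simp add: algebra_simps)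
qed

lemma ex_poly_root_mod_extra_factor:
  fixes f g q :: "real poly"
  assumes m: "m > 0" and quotient: "poly f l / poly g l > 0" and "q dvd p ^ m * g - f"
  shows "\<exists>p'. [:- l, 1:] * q dvd p' ^ m * g - f"
proof -
  obtain r where r: "p ^ m * g - f = q * r" using assms(3) by (elim dvdE)
  define P where "P c = p + [:c:] * q" for c
  define R where "R c = r + [:c:] * (\<Sum>i<m. p ^ (m - Suc i) * P c ^ i) * g" for c
  have shifted: "P c ^ m * g - f = q * R c" for c
    unfolding P_def R_def by (rule power_shift_factor[OF r])
  have "\<exists>c. poly (R c) l = 0"
  proof (cases "poly q l = 0")
    case False
    define c where "c = (root m (poly f l / poly g l) - poly p l) / poly q l"
    have "poly (P c) l = root m (poly f l / poly g l)" using False by (simp add: P_def c_def)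
    hence "poly (P c ^ m * g - f) l = 0" using m quotient by (auto simp: poly_power)
    thus ?thesis using False unfolding shifted by auto
  next
    case True
    have "poly (p ^ m * g - f) l = 0" unfolding r using True by simp
    moreover have "poly g l \<noteq> 0" using quotient by auto
    ultimately have "poly p l ^ m = poly f l / poly g l" by (simp add: poly_power field_simps)
    hence "poly p l \<noteq> 0" using quotient m by (auto simp: zero_power)
    moreover have "poly (R c) l = poly r l + c * (real m * poly p l ^ (m - 1)) * poly g l" for c
      using True by (simp add: R_def P_def poly_sum poly_power power_add[symmetric])
    ultimately have "poly (R (- poly r l / (real m * poly p l ^ (m - 1) * poly g l))) l = 0"
      using quotient m by auto
    thus ?thesis ..
  qed
  then obtain c where "[:- l, 1:] dvd R c" unfolding poly_eq_0_iff_dvd by blast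
  hence "[:- l, 1:] * q dvd P c ^ m * g - f"
    unfolding shifted mult.commute[of _ q] by (rule mult_dvd_mono[OF dvd_refl])
  thus ?thesis ..
qed

lemma ex_poly_root_mod_linear_factors:
  fixes f g :: "real poly"
  assumes m: "m > 0" and "\<And>l. l \<in> set ls \<Longrightarrow> poly f l / poly g l > 0"
  shows "\<exists>p. (\<Prod>l\<leftarrow>ls. [:- l, 1:]) dvd p ^ m * g - f"
  using assms(2)
proof (induction ls)
  case (Cons l ls)
  then obtain p where "(\<Prod>l\<leftarrow>ls. [:- l, 1:]) dvd p ^ m * g - f" by auto
  thus ?case using ex_poly_root_mod_extra_factor[OF m] Cons.prems by simp
qed simp

lemma linear_power_de_Moivre_mod:
  "[:1, 0, 1:] dvd [:cos t, sin t:] ^ k - [:cos (real k * t), sin (real k * t):]"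
proof (induction k)
  case (Suc k)
  have "[:cos t, sin t:] ^ Suc k - [:cos (real (Suc k) * t), sin (real (Suc k) * t):] =
      [:cos t, sin t:] * ([:cos t, sin t:] ^ k - [:cos (real k * t), sin (real k * t):])
      + Polynomial.smult (sin t * sin (real k * t)) [:1, 0, 1:]"
    by (simp add: algebra_simps cos_add sin_add)
  thus ?case using Suc by (metis dvd_add dvd_mult dvd_refl dvd_smult)
qed (simp add: one_pCons)

lemma ex_dual_coefficients:
  fixes c :: "nat \<Rightarrow> 'a :: field"
  assumes "c k \<noteq> 0" and zero: "\<And>t. t > k \<Longrightarrow> c t = 0"
  shows "\<exists>a. \<forall>t. (\<Sum>j\<le>k. a j * c (t + j)) = (if t = k then 1 else 0)"
proof (intro exI allI)
  define C where "C = Abs_fps (\<lambda>i. if i \<le> k then c (k - i) else 0)"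
  define a where "a = fps_nth (inverse C)"
  fix t
  show "(\<Sum>j\<le>k. a j * c (t + j)) = (if t = k then 1 else 0)"
  proof (cases "t \<le> k")
    case True
    have "(\<Sum>j\<le>k. a j * c (t + j)) = (\<Sum>j = 0..k - t. a j * c (t + j))"
      using zero by (intro sum.mono_neutral_right) auto
    also have "\<dots> = fps_nth (inverse C * C) (k - t)"
      unfolding fps_mult_nth
    proof (intro sum.cong)
      fix j assume "j \<in> {0..k - t}"
      hence "k - (k - t - j) = t + j" using True by auto
      thus "a j * c (t + j) = fps_nth (inverse C) j * fps_nth C (k - t - j)" by (simp add: a_def C_def)
    qed simp
    also have "inverse C * C = 1"
      using assms(1) by (intro inverse_mult_eq_1) (simp add: C_def)
    finally show ?thesis using True by auto
  next
    case False
    thus ?thesis using zero by simp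
  qed
qed

section \<open>Complex matrices\<close>

interpretation cnj_hom: comm_ring_hom cnj
  by unfold_locales auto

interpretation cnj_poly_hom: map_poly_comm_ring_hom cnj ..

interpretation of_real_poly_hom: map_poly_comm_ring_hom complex_of_real ..

lemma mult_mat_assoc:
  "dim_col A = dim_row B \<Longrightarrow> dim_col B = dim_row C \<Longrightarrow> A * B * C = A * (B * C)"
  for A B C :: "'a :: semiring_0 mat"
  by (rule assoc_mult_mat[OF carrier_matI carrier_matI carrier_matI]) auto

lemma mult_mat_vec_assoc:
  "dim_col A = dim_row B \<Longrightarrow> dim_col B = dim_vec v \<Longrightarrow> A * B *\<^sub>v v = A *\<^sub>v (B *\<^sub>v v)"
  for A B :: "'a :: semiring_0 mat"
  by (rule assoc_mult_mat_vec[OF carrier_matI carrier_matI carrier_vecI]) auto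

lemma mult_mat_vec_carrier_iff [simp]: "A *\<^sub>v v \<in> carrier_vec n \<longleftrightarrow> dim_row A = n"
  by (simp add: carrier_dim_vec)

lemma smult_zero_vec [simp]: "a \<cdot>\<^sub>v 0\<^sub>v n = (0\<^sub>v n :: 'a :: mult_zero vec)"
  by (intro eq_vecI) auto

lemma mult_mat_zero_vec [simp]: "dim_col A = n \<Longrightarrow> A *\<^sub>v 0\<^sub>v n = (0\<^sub>v (dim_row A) :: 'a :: semiring_0 vec)"
  by (intro eq_vecI) auto

lemma smult_vec_eq_0_iff:
  "a \<cdot>\<^sub>v x = 0\<^sub>v n \<longleftrightarrow> dim_vec x = n \<and> (a = 0 \<or> x = 0\<^sub>v n)" for x :: "'a :: semidom vec"
  by (auto simp: vec_eq_iff)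

lemma zero_smult_vec [simp]: "0 \<cdot>\<^sub>v x = (0\<^sub>v (dim_vec x) :: 'a :: mult_zero vec)"
  by (intro eq_vecI) auto

lemma smult_one_mult_vec:
  "x \<in> carrier_vec n \<Longrightarrow> (a \<cdot>\<^sub>m 1\<^sub>m n) *\<^sub>v x = a \<cdot>\<^sub>v (x :: 'a :: comm_semiring_1 vec)"
  by (intro eq_vecI) (auto simp: row_smult)

lemma mult_mat_unit_vec [simp]:
  "dim_col A = n \<Longrightarrow> i < n \<Longrightarrow> A *\<^sub>v unit_vec n i = col A i" for A :: "'a :: semiring_1 mat"
  by (intro eq_vecI) auto

lemma smult_mult_mat: "dim_col A = dim_row B \<Longrightarrow> a \<cdot>\<^sub>m A * B = a \<cdot>\<^sub>m (A * B)"
  for A B :: "'a :: comm_semiring_0 mat"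
  by (rule mult_smult_assoc_mat[OF carrier_matI carrier_matI]) auto

lemma mult_smult_mat: "dim_col A = dim_row B \<Longrightarrow> A * (a \<cdot>\<^sub>m B) = a \<cdot>\<^sub>m (A * B)"
  for A B :: "'a :: comm_semiring_0 mat"
  by (rule mult_smult_distrib[OF carrier_matI carrier_matI]) auto

lemma pow_mat_mult_distrib:
  fixes A :: "'a :: semiring_1 mat"
  assumes A: "A \<in> carrier_mat d d" and B: "B \<in> carrier_mat d d" and "A * B = B * A"
  shows "(A * B) ^\<^sub>m k = A ^\<^sub>m k * B ^\<^sub>m k"
proof -
  interpret semiring "ring_mat TYPE('a) d ()" by (rule semiring_mat)
  show ?thesis
    using pow_mult_distrib[of A B k] assms
    unfolding pow_mat_ring_pow[OF A, of _ "()"] pow_mat_ring_pow[OF B, of _ "()"]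
      pow_mat_ring_pow[OF mult_carrier_mat[OF A B], of _ "()"]
    by (simp add: ring_mat_simps)
qed

lemma left_invertible_mat_dim_le:
  fixes S :: "'a :: field mat"
  assumes S: "S \<in> carrier_mat a b" and X: "X \<in> carrier_mat b a" and XS: "X * S = 1\<^sub>m b"
  shows "b \<le> a"
proof (rule ccontr)
  assume "\<not> b \<le> a"
  then obtain c where b: "b = a + c" and c: "c > 0" by (metis less_imp_add_positive not_le)
  define S' where "S' = four_block_mat S (0\<^sub>m a 0) (0\<^sub>m c b) (0\<^sub>m c 0)"
  define X' where "X' = four_block_mat X (0\<^sub>m b c) (0\<^sub>m 0 a) (0\<^sub>m 0 c)"
  have carriers: "S' \<in> carrier_mat b b" "X' \<in> carrier_mat b b"
    using four_block_carrier_mat[OF S zero_carrier_mat[of c 0]]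
      four_block_carrier_mat[OF X zero_carrier_mat[of 0 c]] by (simp_all add: S'_def X'_def b)
  have "X' * S' = 1\<^sub>m b"
    unfolding X'_def S'_def using X S XS
    by (subst mult_four_block_mat[of _ b a _ c _ 0 _ _ b _ 0]) auto
  hence "S' * X' = 1\<^sub>m b" by (rule mat_mult_left_right_inverse[OF carriers(2,1)])
  moreover have "(S' * X') $$ (a, a) = 0"
    unfolding X'_def S'_def using X S c
    by (subst mult_four_block_mat[of _ a b _ 0 _ c _ _ a _ c]) (auto simp: b)
  ultimately show False using c by (simp add: b)
qed

lemma mat_adjoint_dim [simp]: "dim_row (mat_adjoint A) = dim_col A" "dim_col (mat_adjoint A) = dim_row A"
  by (simp_all add: mat_adjoint_def)

lemma mat_adjoint_carrier [simp]: "A \<in> carrier_mat r c \<Longrightarrow> mat_adjoint A \<in> carrier_mat c r"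
  by (intro carrier_matI) simp_all

lemma index_mat_adjoint [simp]:
  "i < dim_col A \<Longrightarrow> j < dim_row A \<Longrightarrow> mat_adjoint A $$ (i, j) = cnj (A $$ (j, i))"
  for A :: "complex mat"
  by (simp add: mat_adjoint_def mat_of_rows_index)

lemma mat_adjoint_conv_transpose: "mat_adjoint A = transpose_mat (map_mat cnj A)"
  by (rule eq_matI) auto

lemma mat_adjoint_adjoint [simp]: "mat_adjoint (mat_adjoint A) = (A :: complex mat)"
  by (rule eq_matI) auto

lemma mat_adjoint_one [simp]: "mat_adjoint (1\<^sub>m d) = (1\<^sub>m d :: complex mat)"
  by (rule eq_matI) auto

lemma mat_adjoint_mult:
  assumes "dim_col A = dim_row B"
  shows "mat_adjoint (A * B) = mat_adjoint B * mat_adjoint (A :: complex mat)"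
  using assms unfolding mat_adjoint_conv_transpose
  by (simp add: cnj_hom.mat_hom_mult[OF carrier_matI carrier_matI]
      transpose_mult[OF carrier_matI carrier_matI])

lemma conjugate_mult_mat_vec:
  assumes "dim_col A = dim_vec x"
  shows "conjugate (A *\<^sub>v x) = map_mat cnj A *\<^sub>v conjugate (x :: complex vec)"
  using assms by (intro eq_vecI) (simp_all add: scalar_prod_def)

lemma cscalar_prod_mat_adjoint:
  assumes "A \<in> carrier_mat r c" "x \<in> carrier_vec c" "y \<in> carrier_vec r"
  shows "y \<bullet>c (A *\<^sub>v x) = (mat_adjoint A *\<^sub>v y) \<bullet>c (x :: complex vec)"
  using assms transpose_vec_mult_scalar[of "map_mat cnj A" r c "conjugate x" y]
  by (simp add: mat_adjoint_conv_transpose conjugate_mult_mat_vec)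

lemma cnj_smult_mat: "map_mat cnj (a \<cdot>\<^sub>m A) = cnj a \<cdot>\<^sub>m map_mat cnj A"
  by (rule eq_matI) auto

lemma mat_adjoint_smult: "mat_adjoint (a \<cdot>\<^sub>m A) = cnj a \<cdot>\<^sub>m mat_adjoint A" for A :: "complex mat"
  by (rule eq_matI) auto

lemma inv_mat_inverse:
  fixes S :: "complex mat"
  assumes S: "S \<in> carrier_mat d d" and "invertible_mat S"
  shows "inv_mat S \<in> carrier_mat d d" "S * inv_mat S = 1\<^sub>m d" "inv_mat S * S = 1\<^sub>m d"
proof -
  have inverse_iff: "inverts_mat S T \<and> inverts_mat T S \<longleftrightarrow>
      T \<in> carrier_mat d d \<and> S * T = 1\<^sub>m d \<and> T * S = 1\<^sub>m d" for T
    using S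
    by (auto simp: inverts_mat_def) (metis carrier_matD carrier_matI index_mult_mat(3)
        index_one_mat(3))+
  have "\<exists>!T. inverts_mat S T \<and> inverts_mat T S"
  proof (rule ex_ex1I)
    show "\<exists>T. inverts_mat S T \<and> inverts_mat T S" using assms(2) by (auto simp: invertible_mat_def)
    fix T T' assume "inverts_mat S T \<and> inverts_mat T S" "inverts_mat S T' \<and> inverts_mat T' S"
    hence T: "T \<in> carrier_mat d d" "T * S = 1\<^sub>m d" and T': "T' \<in> carrier_mat d d" "S * T' = 1\<^sub>m d"
      by (auto simp: inverse_iff)
    have "T * S * T' = T * (S * T')" by (rule assoc_mult_mat[OF T(1) S T'(1)])
    thus "T = T'" using T T' by simp
  qed
  hence "inverts_mat S (inv_mat S) \<and> inverts_mat (inv_mat S) S" unfolding inv_mat_def by (rule theI')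
  thus "inv_mat S \<in> carrier_mat d d" "S * inv_mat S = 1\<^sub>m d" "inv_mat S * S = 1\<^sub>m d"
    by (simp_all add: inverse_iff)
qed

section \<open>Polynomials in a matrix\<close>

definition poly_mat :: "'a :: comm_ring_1 mat \<Rightarrow> 'a poly \<Rightarrow> 'a mat" where
  "poly_mat A p = fold_coeffs (\<lambda>a M. a \<cdot>\<^sub>m 1\<^sub>m (dim_row A) + A * M) p (0\<^sub>m (dim_row A) (dim_row A))"

context
  fixes A :: "'a :: comm_ring_1 mat" and d :: nat
  assumes A: "A \<in> carrier_mat d d"
begin

lemma poly_mat_0: "poly_mat A 0 = 0\<^sub>m d d"
  using A by (simp add: poly_mat_def)

lemma poly_mat_pCons: "poly_mat A (pCons a p) = a \<cdot>\<^sub>m 1\<^sub>m d + A * poly_mat A p"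
proof (cases "a = 0 \<and> p = 0")
  case True
  thus ?thesis using A by (auto simp: poly_mat_0 intro!: eq_matI)
next
  case False
  hence "coeffs (pCons a p) = a # coeffs p" by (auto simp: cCons_def)
  thus ?thesis using A by (simp add: poly_mat_def fold_coeffs_def)
qed

lemma poly_mat_carrier: "poly_mat A p \<in> carrier_mat d d"
  using A by (induction p) (simp_all add: poly_mat_0 poly_mat_pCons mult_carrier_mat[of _ d d])

lemma poly_mat_dim: "dim_row (poly_mat A p) = d" "dim_col (poly_mat A p) = d"
  using poly_mat_carrier by blast+

lemma poly_mat_linear: "poly_mat A [:b, a:] = b \<cdot>\<^sub>m 1\<^sub>m d + a \<cdot>\<^sub>m A"
  using A by (auto simp: poly_mat_pCons poly_mat_0 intro!: eq_matI)

lemma poly_mat_const: "poly_mat A [:a:] = a \<cdot>\<^sub>m 1\<^sub>m d"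
  using A by (auto simp: poly_mat_pCons poly_mat_0 intro!: eq_matI)

lemma poly_mat_X: "poly_mat A [:0, 1:] = A"
  using A by (auto simp: poly_mat_linear intro!: eq_matI)

lemma poly_mat_1: "poly_mat A 1 = 1\<^sub>m d"
  by (auto simp: one_pCons poly_mat_const intro!: eq_matI)

lemma poly_mat_add: "poly_mat A (p + q) = poly_mat A p + poly_mat A q"
proof (induction p q rule: poly_induct2)
  case (pCons a p b q)
  have "A * (poly_mat A p + poly_mat A q) = A * poly_mat A p + A * poly_mat A q"
    by (rule mult_add_distrib_mat[OF A poly_mat_carrier poly_mat_carrier])
  thus ?case using A pCons
    by (auto simp: poly_mat_pCons poly_mat_dim distrib_right simp del: index_mult_mat(1)
        intro!: eq_matI)
qed (simp add: poly_mat_0)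

lemma poly_mat_smult: "poly_mat A (Polynomial.smult a p) = a \<cdot>\<^sub>m poly_mat A p"
proof (induction p)
  case (pCons b p)
  have "A * (a \<cdot>\<^sub>m poly_mat A p) = a \<cdot>\<^sub>m (A * poly_mat A p)"
    by (rule mult_smult_distrib[OF A poly_mat_carrier])
  thus ?case using A pCons.IH
    by (auto simp: poly_mat_pCons poly_mat_dim distrib_left simp del: index_mult_mat(1) intro!: eq_matI)
qed (simp add: poly_mat_0)

lemma poly_mat_mult: "poly_mat A (p * q) = poly_mat A p * poly_mat A q"
proof (induction p)
  case 0
  show ?case using poly_mat_carrier[of q] by (simp add: poly_mat_0)
next
  case (pCons a p)
  note carriers = A poly_mat_carrier[of p] poly_mat_carrier[of q]
  have "poly_mat A (pCons 0 (p * q)) = A * (poly_mat A p * poly_mat A q)"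
    using A by (auto simp: poly_mat_pCons pCons.IH poly_mat_dim intro!: eq_matI)
  hence "poly_mat A (pCons a p * q) = a \<cdot>\<^sub>m poly_mat A q + A * (poly_mat A p * poly_mat A q)"
    by (simp add: poly_mat_add poly_mat_smult)
  also have "\<dots> = (a \<cdot>\<^sub>m 1\<^sub>m d + A * poly_mat A p) * poly_mat A q"
    using carriers mult_smult_assoc_mat[OF one_carrier_mat carriers(3), of a]
    by (simp add: add_mult_distrib_mat[of _ d d _ _ d] mult_carrier_mat[of _ d d] mult_mat_assoc)
  finally show ?case by (simp add: poly_mat_pCons)
qed

lemma poly_mat_power: "poly_mat A (p ^ k) = poly_mat A p ^\<^sub>m k"
  using poly_mat_carrier[of p]
  by (induction k) (simp_all add: poly_mat_1 poly_mat_mult mult.commute[of p])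

lemma poly_mat_commute:
  assumes X: "X \<in> carrier_mat d d" and XA: "X * A = A * X"
  shows "X * poly_mat A p = poly_mat A p * X"
proof (induction p)
  case 0
  show ?case using X by (simp add: poly_mat_0)
next
  case (pCons a p)
  note carriers = A X poly_mat_carrier[of p]
  have "X * (A * poly_mat A p) = X * A * poly_mat A p"
    by (rule assoc_mult_mat[OF X A carriers(3), symmetric])
  also have "\<dots> = A * poly_mat A p * X"
    unfolding XA using carriers by (simp add: mult_mat_assoc pCons.IH)
  finally have "X * (A * poly_mat A p) = A * poly_mat A p * X" .
  moreover have "X * (a \<cdot>\<^sub>m 1\<^sub>m d) = a \<cdot>\<^sub>m 1\<^sub>m d * X"
    using X
    by (simp add: mult_smult_distrib[OF X one_carrier_mat] mult_smult_assoc_mat[OF one_carrier_mat X])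
  ultimately show ?case using carriers
    by (simp add: poly_mat_pCons mult_add_distrib_mat[of _ d d _ d] add_mult_distrib_mat[of _ d d _ _ d]
        mult_carrier_mat[of _ d d])
qed

lemma poly_mat_cong_mod:
  assumes "poly_mat A q = 0\<^sub>m d d" and "q dvd p - p'"
  shows "poly_mat A p = poly_mat A p'"
proof -
  obtain r where "p = q * r + p'" using assms(2) by (elim dvdE) (simp add: diff_eq_eq)
  thus ?thesis
    using assms(1) poly_mat_carrier[of r] poly_mat_carrier[of p']
    by (simp add: poly_mat_add poly_mat_mult)
qed

lemma index_poly_mat_sum:
  "i < d \<Longrightarrow> j < d \<Longrightarrow> poly_mat A (sum f I) $$ (i, j) = (\<Sum>k\<in>I. poly_mat A (f k) $$ (i, j))"
  by (induction I rule: infinite_finite_induct) (simp_all add: poly_mat_0 poly_mat_add poly_mat_dim)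

lemma char_poly_matrix_annihilated:
  assumes "l < d" "s < d"
  shows "(\<Sum>k<d. poly_mat A (char_poly_matrix A $$ (k, l)) $$ (s, k)) = 0"
proof -
  have "poly_mat A (char_poly_matrix A $$ (k, l)) $$ (s, k) =
      (if k = l then A $$ (s, k) else 0) - (if s = k then A $$ (k, l) else 0)" if "k < d" for k
    using that assms A by (auto simp: char_poly_matrix_def poly_mat_linear poly_mat_const one_pCons)
  thus ?thesis using assms by (simp add: sum_subtractf)
qed

text \<open>The identity \<open>C * adj C = det C\<close> for \<open>C = x - A\<close> is evaluated at \<open>x = A\<close> by sending a column \<open>p\<close> of
  polynomials to the sum of the vectors \<open>p\<^sub>k(A) e\<^sub>k\<close>, which kills the columns of \<open>C\<close>.\<close>

theorem cayley_hamilton: "poly_mat A (char_poly A) = 0\<^sub>m d d"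
proof (rule eq_matI)
  fix i j assume "i < dim_row (0\<^sub>m d d :: 'a mat)" "j < dim_col (0\<^sub>m d d :: 'a mat)"
  hence ij: "i < d" "j < d" by auto
  define C where "C = char_poly_matrix A"
  define M where "M = adj_mat C"
  have C: "C \<in> carrier_mat d d" using A by (simp add: C_def)
  have M: "M \<in> carrier_mat d d" "C * M = char_poly A \<cdot>\<^sub>m 1\<^sub>m d"
    using adj_mat[OF C] by (auto simp: M_def C_def char_poly_def)
  have "poly_mat A (char_poly A) $$ (i, j) = (\<Sum>k<d. poly_mat A ((C * M) $$ (k, j)) $$ (i, k))"
  proof -
    have "poly_mat A ((C * M) $$ (k, j)) $$ (i, k) =
        (if k = j then poly_mat A (char_poly A) $$ (i, j) else 0)" if "k < d" for k
      using that ij by (auto simp: M(2) poly_mat_0)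
    thus ?thesis using ij by simp
  qed
  also have "\<dots> =
      (\<Sum>k<d. \<Sum>l<d. \<Sum>s<d. poly_mat A (M $$ (l, j)) $$ (i, s) * poly_mat A (C $$ (k, l)) $$ (s, k))"
  proof (intro sum.cong refl)
    fix k assume "k \<in> {..<d}"
    hence k: "k < d" by simp
    have "(C * M) $$ (k, j) = (\<Sum>l<d. M $$ (l, j) * C $$ (k, l))"
      using k ij C M(1) by (simp add: scalar_prod_def atLeast0LessThan mult.commute)
    thus "poly_mat A ((C * M) $$ (k, j)) $$ (i, k) =
        (\<Sum>l<d. \<Sum>s<d. poly_mat A (M $$ (l, j)) $$ (i, s) * poly_mat A (C $$ (k, l)) $$ (s, k))"
      using k ij
      by (simp add: index_poly_mat_sum poly_mat_mult poly_mat_dim scalar_prod_def atLeast0LessThan)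
  qed
  also have "\<dots> = (\<Sum>l<d. \<Sum>s<d. poly_mat A (M $$ (l, j)) $$ (i, s) *
      (\<Sum>k<d. poly_mat A (C $$ (k, l)) $$ (s, k)))"
    unfolding sum_distrib_left by (subst sum.swap) (rule sum.cong[OF refl sum.swap])
  also have "\<dots> = 0" by (simp add: C_def char_poly_matrix_annihilated)
  finally show "poly_mat A (char_poly A) $$ (i, j) = 0\<^sub>m d d $$ (i, j)" using ij by simp
qed (auto simp: poly_mat_dim)

end

section \<open>Block matrices\<close>

lemma split_four_block_mat:
  assumes "A \<in> carrier_mat a b" "B \<in> carrier_mat a b'" "C \<in> carrier_mat a' b" "D \<in> carrier_mat a' b'"
  shows "split_block (four_block_mat A B C D) a b = (A, B, C, D)"
  using assms by (auto simp: split_block_def Let_def intro!: eq_matI)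

lemma four_block_mat_eq_iff:
  assumes "A \<in> carrier_mat a b" "B \<in> carrier_mat a b'" "C \<in> carrier_mat a' b" "D \<in> carrier_mat a' b'"
    and "A' \<in> carrier_mat a b" "B' \<in> carrier_mat a b'" "C' \<in> carrier_mat a' b" "D' \<in> carrier_mat a' b'"
  shows "four_block_mat A B C D = four_block_mat A' B' C' D' \<longleftrightarrow> A = A' \<and> B = B' \<and> C = C' \<and> D = D'"
proof
  assume eq: "four_block_mat A B C D = four_block_mat A' B' C' D'"
  have "(A, B, C, D) = split_block (four_block_mat A' B' C' D') a b"
    by (simp only: split_four_block_mat[OF assms(1-4)] flip: eq)
  thus "A = A' \<and> B = B' \<and> C = C' \<and> D = D'" by (simp add: split_four_block_mat[OF assms(5-8)])
qed simp

definition hcat :: "'a :: zero mat \<Rightarrow> 'a mat \<Rightarrow> 'a mat" where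
  "hcat X Y = four_block_mat X Y (0\<^sub>m 0 (dim_col X)) (0\<^sub>m 0 (dim_col Y))"

lemma hcat_carrier: "X \<in> carrier_mat r a \<Longrightarrow> Y \<in> carrier_mat r b \<Longrightarrow> hcat X Y \<in> carrier_mat r (a + b)"
  by (auto simp: hcat_def)

lemma col_hcat:
  assumes "X \<in> carrier_mat r a" "Y \<in> carrier_mat r b" "j < a + b"
  shows "col (hcat X Y) j = (if j < a then col X j else col Y (j - a))"
  using assms by (intro eq_vecI) (auto simp: hcat_def)

lemma mult_hcat:
  fixes M :: "'a :: comm_semiring_1 mat"
  assumes M: "M \<in> carrier_mat r' r" and X: "X \<in> carrier_mat r a" and Y: "Y \<in> carrier_mat r b"
  shows "M * hcat X Y = hcat (M * X) (M * Y)"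
proof (rule mat_col_eqI)
  fix j assume "j < dim_col (hcat (M * X) (M * Y))"
  hence j: "j < a + b" using X Y by (simp add: hcat_def)
  have "col (M * hcat X Y) j = M *\<^sub>v col (hcat X Y) j" by (rule col_mult2[OF M hcat_carrier[OF X Y] j])
  also have "\<dots> = col (hcat (M * X) (M * Y)) j"
    using j col_mult2[OF M X] col_mult2[OF M Y]
    by (simp add: col_hcat[OF X Y] col_hcat[OF mult_carrier_mat[OF M X] mult_carrier_mat[OF M Y]])
  finally show "col (M * hcat X Y) j = col (hcat (M * X) (M * Y)) j" .
qed (use assms in \<open>auto simp: hcat_def\<close>)

lemma smult_hcat:
  "dim_row X = dim_row Y \<Longrightarrow> a \<cdot>\<^sub>m hcat X Y = hcat (a \<cdot>\<^sub>m X) (a \<cdot>\<^sub>m (Y :: 'a :: mult_zero mat))"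
  unfolding hcat_def by (rule eq_matI) auto

definition block_diag :: "'a :: zero mat \<Rightarrow> 'a mat \<Rightarrow> 'a mat" where
  "block_diag A D = four_block_mat A (0\<^sub>m (dim_row A) (dim_col D)) (0\<^sub>m (dim_row D) (dim_col A)) D"

lemma block_diag_carrier [simp]:
  "A \<in> carrier_mat a a' \<Longrightarrow> D \<in> carrier_mat b b' \<Longrightarrow> block_diag A D \<in> carrier_mat (a + b) (a' + b')"
  by (simp add: block_diag_def)

lemma block_diag_dim [simp]:
  "dim_row (block_diag A D) = dim_row A + dim_row D" "dim_col (block_diag A D) = dim_col A + dim_col D"
  by (simp_all add: block_diag_def)

lemma block_diag_mult:
  assumes "dim_col A = dim_row A'" "dim_col D = dim_row D'"
  shows "block_diag A D * block_diag A' D' = block_diag (A * A') (D * D' :: 'a :: comm_semiring_1 mat)"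
  unfolding block_diag_def using assms
  by (subst mult_four_block_mat[of A "dim_row A" "dim_col A" _ "dim_col D" _ "dim_row D" D
        A' "dim_col A'" _ "dim_col D'"])
    auto

lemma map_block_diag: "f 0 = 0 \<Longrightarrow> map_mat f (block_diag A D) = block_diag (map_mat f A) (map_mat f D)"
  unfolding block_diag_def by (rule eq_matI) auto

lemma smult_block_diag: "a \<cdot>\<^sub>m block_diag A D = block_diag (a \<cdot>\<^sub>m A) (a \<cdot>\<^sub>m (D :: 'a :: mult_zero mat))"
  unfolding block_diag_def by (rule eq_matI) auto

lemma uminus_block_diag: "- block_diag A D = block_diag (- A) (- D :: 'a :: group_add mat)"
  unfolding block_diag_def by (rule eq_matI) auto

lemma block_diag_one: "block_diag (1\<^sub>m a) (1\<^sub>m b) = 1\<^sub>m (a + b)"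
  by (simp add: block_diag_def)

lemma mat_adjoint_block_diag:
  "mat_adjoint (block_diag A D) = block_diag (mat_adjoint A) (mat_adjoint D :: complex mat)"
  unfolding block_diag_def by (rule eq_matI) auto

lemma diag_block_mat_append_eq:
  "diag_block_mat (As @ Bs) = block_diag (diag_block_mat As) (diag_block_mat Bs)"
  by (simp add: block_diag_def diag_block_mat_append Let_def)

lemma hcat_mult_block_diag:
  fixes X :: "'a :: comm_semiring_1 mat"
  assumes "X \<in> carrier_mat r a" "Y \<in> carrier_mat r b" "A \<in> carrier_mat a a'" "D \<in> carrier_mat b b'"
  shows "hcat X Y * block_diag A D = hcat (X * A) (Y * D)"
  unfolding hcat_def block_diag_def using assms
  by (subst mult_four_block_mat[of X r a Y b _ 0 _ A a' _ b']) auto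

section \<open>The quaternionic structure\<close>

text \<open>The antilinear map \<open>quat_conj N\<close> is the action of the quaternion unit \<open>j\<close> on
  \<open>\<complex>\<^sup>2\<^sup>N\<close>; the set \<open>Omega N\<close> consists of the matrices commuting with it.\<close>

definition quat_mat :: "nat \<Rightarrow> complex mat" where
  "quat_mat N = four_block_mat (0\<^sub>m N N) (- 1\<^sub>m N) (1\<^sub>m N) (0\<^sub>m N N)"

definition quat_conj :: "nat \<Rightarrow> complex vec \<Rightarrow> complex vec" where
  "quat_conj N x = quat_mat N *\<^sub>v conjugate x"

definition quat_conj_mat :: "nat \<Rightarrow> complex mat \<Rightarrow> complex mat" where
  "quat_conj_mat N X = quat_mat N * map_mat cnj X"

lemma quat_mat_carrier [simp]: "quat_mat N \<in> carrier_mat (N + N) (N + N)"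
  unfolding quat_mat_def by auto

lemma quat_mat_dim [simp]: "dim_row (quat_mat N) = N + N" "dim_col (quat_mat N) = N + N"
  unfolding quat_mat_def by auto

lemma four_block_mat_mult_quat_mat:
  assumes "A \<in> carrier_mat a N" "B \<in> carrier_mat a N" "C \<in> carrier_mat b N" "D \<in> carrier_mat b N"
  shows "four_block_mat A B C D * quat_mat N = four_block_mat B (- A) D (- C)"
  unfolding quat_mat_def using assms
  by (subst mult_four_block_mat[of _ a N _ N _ b _ _ N _ N]) auto

lemma quat_mat_mult_four_block_mat:
  assumes "A \<in> carrier_mat N a" "B \<in> carrier_mat N b" "C \<in> carrier_mat N a" "D \<in> carrier_mat N b"
  shows "quat_mat N * four_block_mat A B C D = four_block_mat (- C) (- D) A B"
  unfolding quat_mat_def using assms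
  by (subst mult_four_block_mat[of _ N N _ N _ N _ _ a _ b]) auto

lemma quat_mat_square: "quat_mat N * quat_mat N = - 1\<^sub>m (N + N)"
proof -
  have "quat_mat N * quat_mat N = four_block_mat (- 1\<^sub>m N) (0\<^sub>m N N) (0\<^sub>m N N) (- 1\<^sub>m N)"
    unfolding quat_mat_def[of N, symmetric]
    by (subst (2) quat_mat_def, subst quat_mat_mult_four_block_mat) auto
  also have "\<dots> = - 1\<^sub>m (N + N)" by (rule eq_matI) auto
  finally show ?thesis .
qed

lemma mat_adjoint_quat_mat: "mat_adjoint (quat_mat N) = - quat_mat N"
  unfolding quat_mat_def by (rule eq_matI) auto

lemma cnj_quat_mat: "map_mat cnj (quat_mat N) = quat_mat N"
  unfolding quat_mat_def by (rule eq_matI) auto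

lemma hcat_mult_quat_mat:
  "X \<in> carrier_mat r a \<Longrightarrow> Y \<in> carrier_mat r a \<Longrightarrow> hcat X Y * quat_mat a = hcat Y (- X)"
  unfolding hcat_def by (subst four_block_mat_mult_quat_mat) (auto intro!: cong_four_block_mat)

lemma four_block_mat_Omega_iff:
  assumes carriers: "A \<in> carrier_mat N N" "B \<in> carrier_mat N N" "C \<in> carrier_mat N N" "D \<in> carrier_mat N N"
  shows "four_block_mat A B C D \<in> Omega N \<longleftrightarrow> B = - map_mat cnj C \<and> D = map_mat cnj A"
proof
  assume "four_block_mat A B C D \<in> Omega N"
  then obtain A1 A2 where "A1 \<in> carrier_mat N N" "A2 \<in> carrier_mat N N"
    and "four_block_mat A B C D = four_block_mat A1 (map_mat cnj A2) (- A2) (map_mat cnj A1)"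
    unfolding Omega_def by blast
  hence "A = A1 \<and> B = map_mat cnj A2 \<and> C = - A2 \<and> D = map_mat cnj A1"
    by (subst (asm) four_block_mat_eq_iff[OF carriers]) auto
  thus "B = - map_mat cnj C \<and> D = map_mat cnj A" by (auto intro!: eq_matI)
next
  assume BD: "B = - map_mat cnj C \<and> D = map_mat cnj A"
  have "four_block_mat A B C D = four_block_mat A (map_mat cnj (- C)) (- (- C)) (map_mat cnj A)"
    using BD by (intro cong_four_block_mat) (auto intro!: eq_matI)
  moreover have "- C \<in> carrier_mat N N" using carriers(3) by simp
  ultimately show "four_block_mat A B C D \<in> Omega N" using carriers(1) unfolding Omega_def by blast
qed

lemma Omega_iff: "M \<in> Omega N \<longleftrightarrow> M \<in> carrier_mat (N + N) (N + N) \<and> quat_conj_mat N M = M * quat_mat N"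
proof (cases "M \<in> carrier_mat (N + N) (N + N)")
  case True
  let ?c = "map_mat cnj"
  obtain A B C D where "split_block M N N = (A, B, C, D)" by (metis prod_cases4)
  from split_block[OF this] True have carriers: "A \<in> carrier_mat N N" "B \<in> carrier_mat N N"
    "C \<in> carrier_mat N N" "D \<in> carrier_mat N N" and M: "M = four_block_mat A B C D" by auto
  have "quat_conj_mat N M = four_block_mat (- ?c C) (- ?c D) (?c A) (?c B)"
    unfolding quat_conj_mat_def M map_four_block_mat[OF carriers]
    using carriers by (intro quat_mat_mult_four_block_mat) auto
  moreover have "M * quat_mat N = four_block_mat B (- A) D (- C)"
    unfolding M by (rule four_block_mat_mult_quat_mat[OF carriers])
  ultimately have "quat_conj_mat N M = M * quat_mat N \<longleftrightarrow>
      - ?c C = B \<and> - ?c D = - A \<and> ?c A = D \<and> ?c B = - C"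
    using carriers by (simp add: four_block_mat_eq_iff[of _ N N _ N _ N])
  also have "\<dots> \<longleftrightarrow> B = - ?c C \<and> D = ?c A" by (auto intro!: eq_matI)
  also have "\<dots> \<longleftrightarrow> M \<in> Omega N" unfolding M by (rule four_block_mat_Omega_iff[OF carriers, symmetric])
  finally show ?thesis using True by blast
qed (auto simp: Omega_def)

lemma Omega_carrier: "M \<in> Omega N \<Longrightarrow> M \<in> carrier_mat (N + N) (N + N)"
  by (simp add: Omega_iff)

lemma quat_conj_mat_carrier [simp]: "dim_col X = r \<Longrightarrow> quat_conj_mat N X \<in> carrier_mat (N + N) r"
  by (intro carrier_matI) (simp_all add: quat_conj_mat_def)

lemma quat_conj_mat_dim [simp]:
  "dim_row (quat_conj_mat N X) = N + N" "dim_col (quat_conj_mat N X) = dim_col X"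
  by (simp_all add: quat_conj_mat_def)

lemma quat_conj_mat_add:
  assumes "X \<in> carrier_mat (N + N) r" "Y \<in> carrier_mat (N + N) r"
  shows "quat_conj_mat N (X + Y) = quat_conj_mat N X + quat_conj_mat N Y"
proof -
  have "map_mat cnj (X + Y) = map_mat cnj X + map_mat cnj Y" using assms by (intro eq_matI) auto
  thus ?thesis
    unfolding quat_conj_mat_def using assms
    by (simp add: mult_add_distrib_mat[OF quat_mat_carrier, of _ _ r])
qed

lemma quat_conj_mat_smult:
  assumes "dim_row X = N + N"
  shows "quat_conj_mat N (a \<cdot>\<^sub>m X) = cnj a \<cdot>\<^sub>m quat_conj_mat N X"
  using assms by (simp add: quat_conj_mat_def cnj_smult_mat mult_smult_mat)

lemma quat_conj_mat_mult:
  assumes "dim_row X = N + N" "dim_col X = dim_row D"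
  shows "quat_conj_mat N (X * D) = quat_conj_mat N X * map_mat cnj D"
  using assms unfolding quat_conj_mat_def
  by (simp add: cnj_hom.mat_hom_mult[OF carrier_matI carrier_matI] mult_mat_assoc)

lemma quat_conj_mat_quat_conj_mat:
  assumes "dim_row X = N + N"
  shows "quat_conj_mat N (quat_conj_mat N X) = - X"
proof -
  have "map_mat cnj (map_mat cnj X) = X" by (intro eq_matI) auto
  moreover have "quat_conj_mat N (quat_conj_mat N X) =
      quat_mat N * quat_mat N * map_mat cnj (map_mat cnj X)"
    using assms unfolding quat_conj_mat_def
    by (simp add: cnj_hom.mat_hom_mult[OF carrier_matI carrier_matI] mult_mat_assoc cnj_quat_mat)
  ultimately show ?thesis using assms by (simp add: quat_mat_square)
qed

lemma quat_conj_mat_hcat: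
  assumes X: "X \<in> carrier_mat (N + N) a" and Y: "Y \<in> carrier_mat (N + N) b"
  shows "quat_conj_mat N (hcat X Y) = hcat (quat_conj_mat N X) (quat_conj_mat N Y)"
proof -
  have "map_mat cnj (hcat X Y) = hcat (map_mat cnj X) (map_mat cnj Y)"
    using assms by (intro eq_matI) (auto simp: hcat_def)
  thus ?thesis unfolding quat_conj_mat_def
    using mult_hcat[OF quat_mat_carrier, of "map_mat cnj X" N a "map_mat cnj Y" b] X Y by simp
qed

lemma Omega_mult_quat_conj_mat:
  assumes "M \<in> Omega N" "dim_row X = N + N"
  shows "M * quat_conj_mat N X = quat_conj_mat N (M * X)"
  using assms Omega_carrier[OF assms(1)] quat_conj_mat_mult[of M N X]
  by (simp add: Omega_iff mult_mat_assoc) (simp add: quat_conj_mat_def)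

lemma Omega_one: "1\<^sub>m (N + N) \<in> Omega N"
  by (simp add: Omega_iff quat_conj_mat_def cnj_hom.mat_hom_one)

lemma Omega_zero: "0\<^sub>m (N + N) (N + N) \<in> Omega N"
proof -
  have "map_mat cnj (0\<^sub>m (N + N) (N + N)) = 0\<^sub>m (N + N) (N + N)" by (rule eq_matI) auto
  thus ?thesis by (simp add: Omega_iff quat_conj_mat_def)
qed

lemma Omega_add: "A \<in> Omega N \<Longrightarrow> B \<in> Omega N \<Longrightarrow> A + B \<in> Omega N"
  by (simp add: Omega_iff quat_conj_mat_add[of A N "N + N" B]
      add_mult_distrib_mat[of _ "N + N" "N + N" _ _ "N + N"])

lemma Omega_smult: "A \<in> Omega N \<Longrightarrow> complex_of_real a \<cdot>\<^sub>m A \<in> Omega N"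
  by (auto simp: Omega_iff quat_conj_mat_smult smult_mult_mat)

lemma Omega_mult:
  assumes "A \<in> Omega N" "B \<in> Omega N"
  shows "A * B \<in> Omega N"
proof -
  have "quat_conj_mat N (A * B) = A * quat_conj_mat N B"
    using assms(2) by (intro Omega_mult_quat_conj_mat[symmetric] assms(1)) (auto simp: Omega_iff)
  thus ?thesis using assms by (auto simp: Omega_iff mult_mat_assoc)
qed

lemma Omega_inverse:
  assumes S: "S \<in> Omega N" and T: "T \<in> carrier_mat (N + N) (N + N)"
    and ST: "S * T = 1\<^sub>m (N + N)" "T * S = 1\<^sub>m (N + N)"
  shows "T \<in> Omega N"
proof -
  have "quat_conj_mat N T = T * S * quat_conj_mat N T" by (simp add: ST)
  also have "\<dots> = T * quat_conj_mat N (S * T)"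
    using T Omega_carrier[OF S] by (simp add: mult_mat_assoc Omega_mult_quat_conj_mat[OF S])
  also have "\<dots> = T * quat_mat N"
    by (simp add: ST quat_conj_mat_def cnj_hom.mat_hom_one)
  finally show ?thesis using T by (simp add: Omega_iff)
qed

lemma block_diag_Omega: "A \<in> carrier_mat N N \<Longrightarrow> block_diag A (map_mat cnj A) \<in> Omega N"
  by (auto simp: block_diag_def four_block_mat_Omega_iff intro!: eq_matI)

lemma quat_conj_carrier [simp]: "quat_conj N x \<in> carrier_vec (N + N)"
  by (auto simp: quat_conj_def intro: carrier_vecI)

lemma quat_conj_dim [simp]: "dim_vec (quat_conj N x) = N + N"
  by (simp add: quat_conj_def)

lemma quat_conj_add:
  assumes "x \<in> carrier_vec (N + N)" "y \<in> carrier_vec (N + N)"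
  shows "quat_conj N (x + y) = quat_conj N x + quat_conj N y"
  using assms unfolding quat_conj_def
  by (simp add: conjugate_add_vec[of _ "N + N"] mult_add_distrib_mat_vec[OF quat_mat_carrier])

lemma quat_conj_smult:
  "x \<in> carrier_vec (N + N) \<Longrightarrow> quat_conj N (a \<cdot>\<^sub>v x) = cnj a \<cdot>\<^sub>v quat_conj N x"
  unfolding quat_conj_def by (simp add: conjugate_smult_vec mult_mat_vec[OF quat_mat_carrier])

lemma quat_conj_zero [simp]: "quat_conj N (0\<^sub>v (N + N)) = 0\<^sub>v (N + N)"
  by (simp add: quat_conj_def)

lemma quat_conj_quat_conj:
  assumes "x \<in> carrier_vec (N + N)"
  shows "quat_conj N (quat_conj N x) = (- 1) \<cdot>\<^sub>v x"
proof -
  have "quat_conj N (quat_conj N x) = quat_mat N * quat_mat N *\<^sub>v x"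
    using assms by (simp add: quat_conj_def conjugate_mult_mat_vec cnj_quat_mat mult_mat_vec_assoc)
  thus ?thesis using assms by (auto simp: quat_mat_square intro!: eq_vecI)
qed

lemma quat_conj_eq_0_iff:
  "x \<in> carrier_vec (N + N) \<Longrightarrow> quat_conj N x = 0\<^sub>v (N + N) \<longleftrightarrow> x = 0\<^sub>v (N + N)"
  using quat_conj_quat_conj[of x N] smult_vec_eq_0_iff[of "- 1" x "N + N"] by auto

lemma Omega_mult_vec_quat_conj:
  assumes M: "M \<in> Omega N" and x: "x \<in> carrier_vec (N + N)"
  shows "M *\<^sub>v quat_conj N x = quat_conj N (M *\<^sub>v x)"
proof -
  have "M *\<^sub>v quat_conj N x = M * quat_mat N *\<^sub>v conjugate x"
    using Omega_carrier[OF M] x by (simp add: quat_conj_def mult_mat_vec_assoc)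
  also have "\<dots> = quat_conj_mat N M *\<^sub>v conjugate x" using M by (simp add: Omega_iff)
  also have "\<dots> = quat_conj N (M *\<^sub>v x)"
    using Omega_carrier[OF M] x
    by (simp add: quat_conj_def quat_conj_mat_def conjugate_mult_mat_vec mult_mat_vec_assoc)
  finally show ?thesis .
qed

lemma col_quat_conj_mat:
  assumes "X \<in> carrier_mat (N + N) r" "j < r"
  shows "col (quat_conj_mat N X) j = quat_conj N (col X j)"
proof -
  have "col (quat_conj_mat N X) j = quat_mat N *\<^sub>v col (map_mat cnj X) j"
    unfolding quat_conj_mat_def using assms by (intro col_mult2[OF quat_mat_carrier]) auto
  also have "col (map_mat cnj X) j = conjugate (col X j)" using assms by (intro eq_vecI) auto
  finally show ?thesis by (simp add: quat_conj_def)
qed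

definition quat_completion :: "nat \<Rightarrow> complex mat \<Rightarrow> complex mat" where
  "quat_completion N U = hcat U (quat_conj_mat N U)"

lemma quat_completion_carrier:
  "U \<in> carrier_mat (N + N) r \<Longrightarrow> quat_completion N U \<in> carrier_mat (N + N) (r + r)"
  unfolding quat_completion_def by (rule hcat_carrier) auto

lemma quat_conj_mat_quat_completion:
  assumes U: "U \<in> carrier_mat (N + N) r"
  shows "quat_conj_mat N (quat_completion N U) = quat_completion N U * quat_mat r"
proof -
  have JU: "quat_conj_mat N U \<in> carrier_mat (N + N) r" using U by auto
  show ?thesis unfolding quat_completion_def quat_conj_mat_hcat[OF U JU] hcat_mult_quat_mat[OF U JU]
    using U by (simp add: quat_conj_mat_quat_conj_mat)
qed

lemma quat_completion_Omega: "U \<in> carrier_mat (N + N) N \<Longrightarrow> quat_completion N U \<in> Omega N"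
  by (simp add: Omega_iff quat_completion_carrier quat_conj_mat_quat_completion)

lemma Omega_mult_quat_completion:
  assumes M: "M \<in> Omega N" and U: "U \<in> carrier_mat (N + N) r" and D: "D \<in> carrier_mat r r"
    and MU: "M * U = U * D"
  shows "M * quat_completion N U = quat_completion N U * block_diag D (map_mat cnj D)"
proof -
  have JU: "quat_conj_mat N U \<in> carrier_mat (N + N) r" using U by auto
  have "M * quat_conj_mat N U = quat_conj_mat N U * map_mat cnj D"
    using U D by (simp add: Omega_mult_quat_conj_mat[OF M] MU quat_conj_mat_mult)
  thus ?thesis unfolding quat_completion_def mult_hcat[OF Omega_carrier[OF M] U JU]
    using D by (simp add: MU hcat_mult_block_diag[OF U JU])
qed

section \<open>Selfadjoint quaternionic matrices\<close>

abbreviation real_poly_mat :: "complex mat \<Rightarrow> real poly \<Rightarrow> complex mat" where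
  "real_poly_mat A p \<equiv> poly_mat A (map_poly complex_of_real p)"

definition quat_selfadjoint :: "nat \<Rightarrow> complex mat \<Rightarrow> complex mat \<Rightarrow> bool" where
  "quat_selfadjoint N H A \<longleftrightarrow> A \<in> Omega N \<and> H_selfadjoint H A"

definition complex_structure :: "nat \<Rightarrow> complex mat \<Rightarrow> complex mat \<Rightarrow> complex mat \<Rightarrow> bool" where
  "complex_structure N H B K \<longleftrightarrow> quat_selfadjoint N H K \<and> K * B = B * K \<and> K * K = - 1\<^sub>m (N + N)"

lemma quat_selfadjoint_carrier: "quat_selfadjoint N H A \<Longrightarrow> A \<in> carrier_mat (N + N) (N + N)"
  by (simp add: quat_selfadjoint_def Omega_carrier)

lemma ex_real_annihilator:
  assumes B: "B \<in> carrier_mat d d" and spectrum: "spectrum_mat B \<subseteq> complex_of_real ` X"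
  obtains ls where "set ls \<subseteq> X"
    and "real_poly_mat B (\<Prod>l\<leftarrow>ls. [:- l, 1:]) = 0\<^sub>m d d"
proof -
  obtain es where es: "char_poly B = (\<Prod>a\<leftarrow>es. [:- a, 1:])" using char_poly_factorized[OF B] by auto
  have "set es \<subseteq> complex_of_real ` X"
  proof
    fix e assume "e \<in> set es"
    hence "poly (char_poly B) e = 0" by (simp add: es poly_prod_list prod_list_zero_iff)
    thus "e \<in> complex_of_real ` X"
      using spectrum eigenvalue_root_char_poly[OF B] by (auto simp: spectrum_mat_def)
  qed
  hence "es \<in> map complex_of_real ` lists X" unfolding lists_image[symmetric] by blast
  then obtain ls where "set ls \<subseteq> X" and ls: "es = map complex_of_real ls" by (auto simp: lists_eq_set)
  moreover have "char_poly B = map_poly complex_of_real (\<Prod>l\<leftarrow>ls. [:- l, 1:])"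
    unfolding es ls of_real_poly_hom.hom_prod_list by (simp add: comp_def hom_distribs)
  ultimately show thesis using that cayley_hamilton[OF B] by simp
qed

lemma real_poly_mat_cong_mod:
  assumes A: "A \<in> carrier_mat d d" and q: "real_poly_mat A q = 0\<^sub>m d d" and "q dvd p - p'"
  shows "real_poly_mat A p = real_poly_mat A p'"
  using assms(3) of_real_poly_hom.hom_dvd[of q "p - p'"]
  by (intro poly_mat_cong_mod[OF A q]) (simp add: of_real_poly_hom.hom_minus)

lemma ex_root_in_real_poly_mat:
  assumes B: "B \<in> carrier_mat d d" and m: "m > 0" and "spectrum_mat B \<subseteq> complex_of_real ` X"
    and pos: "\<And>x. x \<in> X \<Longrightarrow> poly f x / poly g x > 0"
  obtains p where "real_poly_mat B p ^\<^sub>m m * real_poly_mat B g = real_poly_mat B f"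
proof -
  obtain ls where ls: "set ls \<subseteq> X"
    and annihilator: "real_poly_mat B (\<Prod>l\<leftarrow>ls. [:- l, 1:]) = 0\<^sub>m d d"
    using ex_real_annihilator[OF B assms(3)] .
  obtain p where p: "(\<Prod>l\<leftarrow>ls. [:- l, 1:]) dvd p ^ m * g - f"
    using ex_poly_root_mod_linear_factors[OF m, of ls f g] ls pos by blast
  have "real_poly_mat B (p ^ m * g) = real_poly_mat B f"
    by (rule real_poly_mat_cong_mod[OF B annihilator p])
  thus thesis using that by (simp add: hom_distribs poly_mat_mult[OF B] poly_mat_power[OF B])
qed

lemma cos_sin_poly_mat_power:
  assumes K: "K \<in> carrier_mat d d" and KK: "K * K = - 1\<^sub>m d" and m: "m > 0"
  shows "real_poly_mat K [:cos (pi / real m), sin (pi / real m):] ^\<^sub>m m = - 1\<^sub>m d"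
proof -
  have "map_poly complex_of_real [:1, 0, 1:] = [:0, 1:] * [:0, 1:] + 1"
    by (simp add: one_pCons hom_distribs)
  hence "real_poly_mat K [:1, 0, 1:] = 0\<^sub>m d d"
    by (simp only: poly_mat_add[OF K] poly_mat_mult[OF K] poly_mat_X[OF K] poly_mat_1[OF K] KK)
      (auto intro!: eq_matI)
  hence "real_poly_mat K ([:cos (pi / real m), sin (pi / real m):] ^ m) =
      real_poly_mat K [:cos (real m * (pi / real m)), sin (real m * (pi / real m)):]"
    by (rule real_poly_mat_cong_mod[OF K _ linear_power_de_Moivre_mod])
  thus ?thesis using m by (auto simp: poly_mat_power[OF K] poly_mat_const[OF K] hom_distribs)
qed

context
  fixes N :: nat and H :: "complex mat"
  assumes H: "H \<in> carrier_mat (N + N) (N + N)"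
begin

lemma quat_selfadjoint_one: "quat_selfadjoint N H (1\<^sub>m (N + N))"
  using H by (simp add: quat_selfadjoint_def H_selfadjoint_def Omega_one)

lemma quat_selfadjoint_zero: "quat_selfadjoint N H (0\<^sub>m (N + N) (N + N))"
proof -
  have "mat_adjoint (0\<^sub>m (N + N) (N + N)) = (0\<^sub>m (N + N) (N + N) :: complex mat)" by (rule eq_matI) auto
  thus ?thesis using H by (simp add: quat_selfadjoint_def H_selfadjoint_def Omega_zero)
qed

lemma quat_selfadjoint_add:
  assumes A: "quat_selfadjoint N H A" and B: "quat_selfadjoint N H B"
  shows "quat_selfadjoint N H (A + B)"
proof -
  note carriers = A[THEN quat_selfadjoint_carrier] B[THEN quat_selfadjoint_carrier]
  have "mat_adjoint (A + B) = mat_adjoint A + mat_adjoint B"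
    using carriers by (intro eq_matI) auto
  thus ?thesis using A B carriers H
    by (simp add: quat_selfadjoint_def H_selfadjoint_def Omega_add mult_add_distrib_mat[OF H carriers]
        add_mult_distrib_mat[of _ "N + N" "N + N" _ _ "N + N"])
qed

lemma quat_selfadjoint_smult:
  assumes A: "quat_selfadjoint N H A"
  shows "quat_selfadjoint N H (complex_of_real a \<cdot>\<^sub>m A)"
proof -
  note carrier = A[THEN quat_selfadjoint_carrier]
  show ?thesis using A carrier H
    by (simp add: quat_selfadjoint_def H_selfadjoint_def Omega_smult mult_smult_mat smult_mult_mat
        mat_adjoint_smult)
qed

lemma quat_selfadjoint_mult:
  assumes A: "quat_selfadjoint N H A" and B: "quat_selfadjoint N H B" and commute: "A * B = B * A"
  shows "quat_selfadjoint N H (A * B)"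
proof -
  note carriers = A[THEN quat_selfadjoint_carrier] B[THEN quat_selfadjoint_carrier]
  have HA: "H * A = mat_adjoint A * H" and HB: "H * B = mat_adjoint B * H"
    using A B by (auto simp: quat_selfadjoint_def H_selfadjoint_def)
  have "H * (A * B) = mat_adjoint A * (H * B)"
    using carriers H by (simp add: HA flip: mult_mat_assoc)
  also have "\<dots> = mat_adjoint (B * A) * H"
    using carriers H by (simp add: HB mat_adjoint_mult mult_mat_assoc)
  finally show ?thesis
    using A B by (simp add: quat_selfadjoint_def H_selfadjoint_def Omega_mult commute)
qed

lemma quat_selfadjoint_poly_mat:
  assumes "quat_selfadjoint N H A"
  shows "quat_selfadjoint N H (real_poly_mat A p)"
proof (induction p)
  case 0
  show ?case using quat_selfadjoint_zero by (simp add: poly_mat_0[OF quat_selfadjoint_carrier[OF assms]])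
next
  case (pCons a p)
  note A = quat_selfadjoint_carrier[OF assms]
  show ?case unfolding of_real_hom.map_poly_pCons_hom poly_mat_pCons[OF A]
    by (intro quat_selfadjoint_add quat_selfadjoint_mult quat_selfadjoint_smult quat_selfadjoint_one
      assms pCons.IH poly_mat_commute[OF A A]) simp
qed

lemma complex_structure_of_square_root:
  assumes C: "quat_selfadjoint N H C"
    and spectrum: "spectrum_mat (C * C) \<subseteq> complex_of_real ` {x. x < 0}"
  shows "\<exists>K. complex_structure N H (C * C) K"
proof -
  let ?d = "N + N"
  define B where "B = C * C"
  have B_sa: "quat_selfadjoint N H B" unfolding B_def by (rule quat_selfadjoint_mult[OF C C refl])
  note carriers = quat_selfadjoint_carrier[OF C] quat_selfadjoint_carrier[OF B_sa]
  obtain p where p: "real_poly_mat B p ^\<^sub>m 2 * real_poly_mat B [:0, 1:] = real_poly_mat B [:- 1:]"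
    using ex_root_in_real_poly_mat[OF carriers(2), of 2 "{x. x < 0}" "[:- 1:]" "[:0, 1:]"] spectrum
    by (auto simp: B_def divide_pos_neg)
  define R where "R = real_poly_mat B p"
  have R: "R \<in> carrier_mat ?d ?d" unfolding R_def by (rule poly_mat_carrier[OF carriers(2)])
  have RRB: "R * R * B = - 1\<^sub>m ?d"
    using p R
    by (auto simp: R_def numeral_2_eq_2 hom_distribs poly_mat_X[OF carriers(2)]
        poly_mat_const[OF carriers(2)])
  have CR: "C * R = R * C"
    unfolding R_def using carriers
    by (intro poly_mat_commute[OF carriers(2)]) (simp_all add: B_def mult_mat_assoc)
  have BR: "B * R = R * B"
    unfolding R_def by (rule poly_mat_commute[OF carriers(2,2) refl])
  have "quat_selfadjoint N H (R * C)"
    using quat_selfadjoint_poly_mat[OF B_sa, of p] C CR unfolding R_def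
    by (intro quat_selfadjoint_mult) simp_all
  moreover have "R * C * B = B * (R * C)"
  proof -
    have "R * C * B = R * B * C" using carriers R by (simp add: B_def mult_mat_assoc)
    thus ?thesis using carriers R by (simp add: mult_mat_assoc flip: BR)
  qed
  moreover have "R * C * (R * C) = - 1\<^sub>m ?d"
  proof -
    have "R * C * (R * C) = R * (C * R) * C" using carriers R by (simp add: mult_mat_assoc)
    also have "\<dots> = R * R * B" unfolding CR using carriers R by (simp add: B_def mult_mat_assoc)
    finally show ?thesis unfolding RRB .
  qed
  ultimately show ?thesis unfolding complex_structure_def B_def by blast
qed

lemma complex_structure_of_even_root:
  assumes A: "quat_selfadjoint N H A" and "even m"
    and spectrum: "spectrum_mat (A ^\<^sub>m m) \<subseteq> complex_of_real ` {x. x < 0}"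
  shows "\<exists>K. complex_structure N H (A ^\<^sub>m m) K"
proof -
  obtain k where m: "m = k + k" using \<open>even m\<close> by (metis evenE mult_2)
  note cA = quat_selfadjoint_carrier[OF A]
  have power: "A ^\<^sub>m j = real_poly_mat A ([:0, 1:] ^ j)" for j
    using cA by (simp add: poly_mat_power poly_mat_X hom_distribs)
  have "A ^\<^sub>m m = A ^\<^sub>m k * A ^\<^sub>m k"
    unfolding m power by (simp add: power_add hom_distribs poly_mat_mult[OF cA])
  moreover have "quat_selfadjoint N H (A ^\<^sub>m k)"
    unfolding power by (rule quat_selfadjoint_poly_mat[OF A])
  ultimately show ?thesis using complex_structure_of_square_root spectrum by simp
qed

lemma root_of_complex_structure:
  assumes B: "quat_selfadjoint N H B" and K: "complex_structure N H B K" and m: "m > 0"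
    and spectrum: "spectrum_mat B \<subseteq> complex_of_real ` {x. x < 0}"
  shows "\<exists>A. quat_selfadjoint N H A \<and> A ^\<^sub>m m = B"
proof -
  let ?d = "N + N"
  have K_sa: "quat_selfadjoint N H K" and KB: "K * B = B * K" and KK: "K * K = - 1\<^sub>m ?d"
    using K by (auto simp: complex_structure_def)
  note cB = quat_selfadjoint_carrier[OF B] and cK = quat_selfadjoint_carrier[OF K_sa]
  obtain p where p: "real_poly_mat B p ^\<^sub>m m * real_poly_mat B 1 = real_poly_mat B [:0, - 1:]"
    using ex_root_in_real_poly_mat[OF cB m spectrum, of "[:0, - 1:]" 1] by auto
  define M where "M = real_poly_mat B p"
  have cM: "M \<in> carrier_mat ?d ?d" by (simp add: M_def poly_mat_carrier[OF cB])
  have "real_poly_mat B [:0, - 1:] = - B"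
    using cB by (auto simp: poly_mat_linear hom_distribs intro!: eq_matI)
  hence Mm: "M ^\<^sub>m m = - B"
    using p cM by (simp add: M_def poly_mat_1[OF cB])
  define Z where "Z = real_poly_mat K [:cos (pi / real m), sin (pi / real m):]"
  have Zm: "Z ^\<^sub>m m = - 1\<^sub>m ?d" unfolding Z_def by (rule cos_sin_poly_mat_power[OF cK KK m])
  have KM: "K * M = M * K" unfolding M_def by (rule poly_mat_commute[OF cB cK KB])
  have MZ: "M * Z = Z * M"
    unfolding Z_def by (rule poly_mat_commute[OF cK _ KM[symmetric]]) (rule cM)
  have cZ: "Z \<in> carrier_mat ?d ?d" by (simp add: Z_def poly_mat_carrier[OF cK])
  have "(M * Z) ^\<^sub>m m = B"
    unfolding pow_mat_mult_distrib[OF cM cZ MZ] Mm Zm using cB by simp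
  moreover have "quat_selfadjoint N H (M * Z)"
    using MZ
    by (intro quat_selfadjoint_mult) (simp_all add: M_def Z_def quat_selfadjoint_poly_mat B K_sa)
  ultimately show ?thesis by blast
qed

end

section \<open>Canonical models\<close>

definition swap_mat :: "nat \<Rightarrow> complex mat" where
  "swap_mat k = four_block_mat (0\<^sub>m k k) (1\<^sub>m k) (1\<^sub>m k) (0\<^sub>m k k)"

definition jordan_model :: "(nat \<times> real) list \<Rightarrow> complex mat" where
  "jordan_model ps = diag_block_mat (jordan_part ps)"

definition sip_model :: "(nat \<times> real) list \<Rightarrow> complex mat" where
  "sip_model ps = diag_block_mat (Q_part ps)"

definition swap_model :: "(nat \<times> real) list \<Rightarrow> complex mat" where
  "swap_model ps = diag_block_mat (map (\<lambda>(k, l). swap_mat k) ps)"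

definition model_size :: "(nat \<times> real) list \<Rightarrow> nat" where
  "model_size ps = (\<Sum>(k, l)\<leftarrow>ps. k + k)"

lemma swap_mat_carrier [simp]: "swap_mat k \<in> carrier_mat (k + k) (k + k)"
  by (simp add: swap_mat_def)

lemma swap_mat_dim [simp]: "dim_row (swap_mat k) = k + k" "dim_col (swap_mat k) = k + k"
  by (simp_all add: swap_mat_def)

lemma Q_mat_carrier [simp]: "Q_mat k \<in> carrier_mat k k"
  by (simp add: Q_mat_def)

lemma Q_mat_dim [simp]: "dim_row (Q_mat k) = k" "dim_col (Q_mat k) = k"
  by (simp_all add: Q_mat_def)

lemma Q_mat_square: "Q_mat k * Q_mat k = 1\<^sub>m k"
proof (rule eq_matI)
  fix i j assume "i < dim_row (1\<^sub>m k :: complex mat)" "j < dim_col (1\<^sub>m k :: complex mat)"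
  hence ij: "i < k" "j < k" by auto
  have "(Q_mat k * Q_mat k) $$ (i, j) =
      (\<Sum>t = 0..<k. (if i + t = k - 1 then 1 else 0) * (if t + j = k - 1 then 1 else 0))"
    using ij by (simp add: Q_mat_def scalar_prod_def)
  also have "\<dots> = (\<Sum>t = 0..<k. if t = k - 1 - i then (if i = j then 1 else 0) else 0)"
    using ij by (intro sum.cong) auto
  also have "\<dots> = (if i = j then 1 else 0)" using ij by (subst sum.delta) auto
  finally show "(Q_mat k * Q_mat k) $$ (i, j) = 1\<^sub>m k $$ (i, j)" using ij by simp
qed auto

lemma swap_mat_square: "swap_mat k * swap_mat k = 1\<^sub>m (k + k)"
  unfolding swap_mat_def by (subst mult_four_block_mat[of _ k k _ k _ k _ _ k _ k]) auto

lemma swap_mat_commute: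
  "X \<in> carrier_mat k k \<Longrightarrow> swap_mat k * block_diag X X = block_diag X X * swap_mat k"
  unfolding swap_mat_def block_diag_def
  by (subst (1 2) mult_four_block_mat[of _ k k _ k _ k _ _ k _ k]) auto

lemma swap_mat_anticommute:
  assumes X: "X \<in> carrier_mat k k"
  shows "block_diag X (- X) * swap_mat k = - (swap_mat k * block_diag X (- X))"
proof -
  have "block_diag X (- X) * swap_mat k = four_block_mat (0\<^sub>m k k) X (- X) (0\<^sub>m k k)"
    unfolding swap_mat_def block_diag_def using X
    by (subst mult_four_block_mat[of _ k k _ k _ k _ _ k _ k]) auto
  moreover have "swap_mat k * block_diag X (- X) = four_block_mat (0\<^sub>m k k) (- X) X (0\<^sub>m k k)"
    unfolding swap_mat_def block_diag_def using X
    by (subst mult_four_block_mat[of _ k k _ k _ k _ _ k _ k]) auto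
  ultimately show ?thesis using X by (auto intro!: eq_matI)
qed

lemma hcat_mult_swap_mat:
  "X \<in> carrier_mat r k \<Longrightarrow> Y \<in> carrier_mat r k \<Longrightarrow> hcat X Y * swap_mat k = hcat Y X"
  unfolding hcat_def swap_mat_def
  by (subst mult_four_block_mat[of _ r k _ k _ 0 _ _ k _ k]) (auto intro!: cong_four_block_mat)

lemma mat_adjoint_swap_mat: "mat_adjoint (swap_mat k) = swap_mat k"
  unfolding swap_mat_def by (rule eq_matI) auto

lemma model_append:
  "jordan_model (ps @ qs) = block_diag (jordan_model ps) (jordan_model qs)"
  "sip_model (ps @ qs) = block_diag (sip_model ps) (sip_model qs)"
  "swap_model (ps @ qs) = block_diag (swap_model ps) (swap_model qs)"
  "model_size (ps @ qs) = model_size ps + model_size qs"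
  by (simp_all add: jordan_model_def sip_model_def swap_model_def model_size_def jordan_part_def
      Q_part_def diag_block_mat_append_eq)

lemma model_singleton:
  "jordan_model [(k, l)] =
     block_diag (jordan_block k (complex_of_real l)) (jordan_block k (complex_of_real l))"
  "sip_model [(k, l)] = block_diag (Q_mat k) (- Q_mat k)"
  "swap_model [(k, l)] = swap_mat k"
  "model_size [(k, l)] = k + k"
  using diag_block_mat_append_eq[of "[jordan_block k (complex_of_real l)]"
      "[jordan_block k (complex_of_real l)]"]
    diag_block_mat_append_eq[of "[Q_mat k]" "[- Q_mat k]"]
  by (simp_all add: jordan_model_def sip_model_def swap_model_def model_size_def jordan_part_def
      Q_part_def diag_block_mat_singleton del: diag_block_mat.simps(2))

lemma model_Nil:
  "jordan_model [] = 0\<^sub>m 0 0" "sip_model [] = 0\<^sub>m 0 0" "swap_model [] = 0\<^sub>m 0 0" "model_size [] = 0"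
  by (simp_all add: jordan_model_def sip_model_def swap_model_def model_size_def jordan_part_def
      Q_part_def)

lemmas model_Cons = model_append[of "[(k, l)]" for k l, simplified append.simps model_singleton]

lemma model_carrier [simp]:
  "jordan_model ps \<in> carrier_mat (model_size ps) (model_size ps)"
  "sip_model ps \<in> carrier_mat (model_size ps) (model_size ps)"
  "swap_model ps \<in> carrier_mat (model_size ps) (model_size ps)"
  by (induction ps) (auto simp: model_Nil model_Cons)

lemma model_dim [simp]:
  "dim_row (jordan_model ps) = model_size ps" "dim_col (jordan_model ps) = model_size ps"
  "dim_row (sip_model ps) = model_size ps" "dim_col (sip_model ps) = model_size ps"
  "dim_row (swap_model ps) = model_size ps" "dim_col (swap_model ps) = model_size ps"
  using model_carrier[of ps] by blast+

lemma swap_model_square: "swap_model ps * swap_model ps = 1\<^sub>m (model_size ps)"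
  by (induction ps) (auto simp: model_Nil model_Cons block_diag_mult swap_mat_square block_diag_one)

lemma sip_model_square: "sip_model ps * sip_model ps = 1\<^sub>m (model_size ps)"
proof (induction ps)
  case (Cons p ps)
  have "- Q_mat k * - Q_mat k = 1\<^sub>m k" for k by (simp add: Q_mat_square)
  thus ?case using Cons by (cases p) (simp add: model_Cons block_diag_mult Q_mat_square block_diag_one)
qed (auto simp: model_Nil)

lemma swap_model_jordan_model: "swap_model ps * jordan_model ps = jordan_model ps * swap_model ps"
  by (induction ps) (auto simp: model_Nil model_Cons block_diag_mult swap_mat_commute)

lemma sip_model_swap_model: "sip_model ps * swap_model ps = - (swap_model ps * sip_model ps)"
  by (induction ps) (auto simp: model_Nil model_Cons block_diag_mult swap_mat_anticommute
      uminus_block_diag)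

lemma mat_adjoint_swap_model: "mat_adjoint (swap_model ps) = swap_model ps"
  by (induction ps) (auto simp: model_Nil model_Cons mat_adjoint_block_diag mat_adjoint_swap_mat)

lemma cnj_swap_model: "map_mat cnj (swap_model ps) = swap_model ps"
proof (induction ps)
  case (Cons p ps)
  have "map_mat cnj (swap_mat k) = swap_mat k" for k
    by (rule eq_matI) (auto simp: swap_mat_def)
  thus ?case using Cons by (cases p) (simp add: model_Cons map_block_diag)
qed (auto simp: model_Nil)

lemma cnj_jordan_model: "map_mat cnj (jordan_model ps) = jordan_model ps"
proof (induction ps)
  case (Cons p ps)
  have "map_mat cnj (jordan_block k (complex_of_real l)) = jordan_block k (complex_of_real l)" for k l
    by (rule eq_matI) (auto simp: jordan_block_def)
  thus ?case using Cons by (cases p) (simp add: model_Cons map_block_diag)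
qed (auto simp: model_Nil)

lemma cnj_sip_model: "map_mat cnj (sip_model ps) = sip_model ps"
proof (induction ps)
  case (Cons p ps)
  have "map_mat cnj (Q_mat k) = Q_mat k" "map_mat cnj (- Q_mat k) = - Q_mat k" for k
    by (auto simp: Q_mat_def intro!: eq_matI)
  thus ?case using Cons by (cases p) (simp add: model_Cons map_block_diag)
qed (auto simp: model_Nil)

definition K_model :: "(nat \<times> real) list \<Rightarrow> complex mat" where
  "K_model ps = \<i> \<cdot>\<^sub>m swap_model ps"

lemma complex_structure_model:
  "complex_structure (model_size ps) (block_diag (sip_model ps) (sip_model ps))
     (block_diag (jordan_model ps) (jordan_model ps)) (block_diag (K_model ps) (map_mat cnj (K_model ps)))"
proof -
  let ?R = "swap_model ps" and ?D = "jordan_model ps" and ?Q = "sip_model ps" and ?d = "model_size ps"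
  have K: "K_model ps = \<i> \<cdot>\<^sub>m ?R" "map_mat cnj (\<i> \<cdot>\<^sub>m ?R) = (- \<i>) \<cdot>\<^sub>m ?R"
    by (simp_all add: K_model_def cnj_smult_mat cnj_swap_model)
  have selfadjoint: "?Q * (a \<cdot>\<^sub>m ?R) = mat_adjoint (a \<cdot>\<^sub>m ?R) * ?Q" if "cnj a = - a" for a
    using that by (auto simp: smult_mult_mat mult_smult_mat mat_adjoint_smult mat_adjoint_swap_model
        sip_model_swap_model intro!: eq_matI)
  have commute: "(a \<cdot>\<^sub>m ?R) * ?D = ?D * (a \<cdot>\<^sub>m ?R)" for a
    by (simp add: smult_mult_mat mult_smult_mat swap_model_jordan_model)
  have square: "(a \<cdot>\<^sub>m ?R) * (a \<cdot>\<^sub>m ?R) = - 1\<^sub>m ?d" if "a * a = - 1" for a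
    using that by (auto simp: smult_mult_mat mult_smult_mat swap_model_square simp flip: mult.assoc
        intro!: eq_matI)
  have "block_diag (K_model ps) (map_mat cnj (K_model ps)) \<in> Omega ?d"
    by (rule block_diag_Omega) (simp add: K_model_def)
  thus ?thesis
    by (simp add: complex_structure_def quat_selfadjoint_def H_selfadjoint_def K block_diag_mult
        mat_adjoint_block_diag selfadjoint commute square flip: uminus_block_diag block_diag_one)
qed

lemma H_selfadjoint_congruence:
  assumes S: "S \<in> carrier_mat d d" and T: "T \<in> carrier_mat d d" and ST: "S * T = 1\<^sub>m d"
    and H: "H \<in> carrier_mat d d" and K: "K \<in> carrier_mat d d"
    and selfadjoint: "H_selfadjoint (mat_adjoint S * H * S) K"
  shows "H_selfadjoint H (S * K * T)"
proof -
  let ?G = "mat_adjoint S * H * S"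
  note carriers = S T H K
  have "mat_adjoint T * (mat_adjoint S * X) = X" if "dim_row X = d" for X
    using that carriers by (simp add: ST flip: mult_mat_assoc mat_adjoint_mult)
  hence "H * (S * K * T) = mat_adjoint T * (?G * K) * T"
    using carriers by (simp add: mult_mat_assoc)
  also have "?G * K = mat_adjoint K * ?G" using selfadjoint by (simp add: H_selfadjoint_def)
  also have "mat_adjoint T * (mat_adjoint K * ?G) * T = mat_adjoint (S * K * T) * H"
    using carriers by (simp add: mult_mat_assoc mat_adjoint_mult ST)
  finally show ?thesis by (simp add: H_selfadjoint_def)
qed

lemma complex_structure_congruence:
  assumes S: "S \<in> Omega N" and T: "T \<in> carrier_mat (N + N) (N + N)"
    and ST: "S * T = 1\<^sub>m (N + N)" and TS: "T * S = 1\<^sub>m (N + N)"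
    and H: "H \<in> carrier_mat (N + N) (N + N)" and B: "B \<in> carrier_mat (N + N) (N + N)"
    and K: "complex_structure N (mat_adjoint S * H * S) (T * B * S) K"
  shows "complex_structure N H B (S * K * T)"
proof -
  let ?d = "N + N"
  have K_Omega: "K \<in> Omega N" and selfadjoint: "H_selfadjoint (mat_adjoint S * H * S) K"
    and KB: "K * (T * B * S) = T * B * S * K" and KK: "K * K = - 1\<^sub>m ?d"
    using K by (auto simp: complex_structure_def quat_selfadjoint_def)
  note carriers = Omega_carrier[OF S] Omega_carrier[OF K_Omega] T H B
  have cancel: "S * (T * X) = X" "T * (S * X) = X" if "dim_row X = ?d" for X
    using that carriers by (simp_all add: ST TS flip: mult_mat_assoc)
  have "H_selfadjoint H (S * K * T)"
    by (rule H_selfadjoint_congruence[OF carriers(1) T ST H carriers(2) selfadjoint])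
  moreover have "S * K * T * B = B * (S * K * T)"
  proof -
    have "S * K * T * B = S * (K * (T * B * S)) * T" using carriers by (simp add: mult_mat_assoc ST)
    also have "\<dots> = B * (S * K * T)" unfolding KB using carriers by (simp add: mult_mat_assoc cancel)
    finally show ?thesis .
  qed
  moreover have "S * K * T * (S * K * T) = - 1\<^sub>m ?d"
  proof -
    have "S * K * T * (S * K * T) = S * (K * K) * T" using carriers by (simp add: mult_mat_assoc cancel)
    thus ?thesis using carriers by (simp add: KK ST)
  qed
  moreover have "S * K * T \<in> Omega N" by (intro Omega_mult S K_Omega Omega_inverse[OF S T ST TS])
  ultimately show ?thesis by (simp add: complex_structure_def quat_selfadjoint_def)
qed

section \<open>Indefinite quaternionic inner products\<close>

locale quaternionic_form =
  fixes N :: nat and H :: "complex mat"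
  assumes H_Omega: "H \<in> Omega N" and H_hermitian: "hermitian_mat H"
begin

abbreviation "d \<equiv> N + N"
abbreviation "V \<equiv> carrier_vec d :: complex vec set"
abbreviation "J \<equiv> quat_conj N"

definition h :: "complex vec \<Rightarrow> complex vec \<Rightarrow> complex" where "h x y = (H *\<^sub>v y) \<bullet>c x"

definition \<omega> :: "complex vec \<Rightarrow> complex vec \<Rightarrow> complex" where "\<omega> x y = h (J x) y"

lemma H_carrier [simp]: "H \<in> carrier_mat d d"
  by (rule Omega_carrier[OF H_Omega])

lemma H_dim [simp]: "dim_row H = d" "dim_col H = d"
  using H_carrier by blast+

lemma h_add_right: "x \<in> V \<Longrightarrow> y \<in> V \<Longrightarrow> z \<in> V \<Longrightarrow> h x (y + z) = h x y + h x z"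
  by (simp add: h_def mult_add_distrib_mat_vec[OF H_carrier] add_scalar_prod_distrib[of _ d])

lemma h_smult_right: "x \<in> V \<Longrightarrow> y \<in> V \<Longrightarrow> h x (a \<cdot>\<^sub>v y) = a * h x y"
  by (simp add: h_def mult_mat_vec[OF H_carrier])

lemma h_mult_mat_left:
  assumes M: "M \<in> carrier_mat d r" and x: "x \<in> carrier_vec r" and y: "y \<in> V"
  shows "h (M *\<^sub>v x) y = (mat_adjoint M * H *\<^sub>v y) \<bullet>c x"
  unfolding h_def using M x y by (simp add: cscalar_prod_mat_adjoint[of M d r] mult_mat_vec_assoc)

lemma cnj_h:
  assumes "x \<in> V" "y \<in> V"
  shows "cnj (h x y) = h y x"
proof -
  have "cnj (h x y) = x \<bullet>c (H *\<^sub>v y)"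
    using assms by (auto simp: h_def scalar_prod_def mult.commute)
  also have "\<dots> = h y x"
    using assms H_hermitian by (simp add: h_def hermitian_mat_def cscalar_prod_mat_adjoint[of _ d d])
  finally show ?thesis .
qed

lemma h_add_left: "x \<in> V \<Longrightarrow> y \<in> V \<Longrightarrow> z \<in> V \<Longrightarrow> h (x + y) z = h x z + h y z"
  using h_add_right[of z x y] by (simp flip: cnj_h[of z])

lemma h_smult_left: "x \<in> V \<Longrightarrow> y \<in> V \<Longrightarrow> h (a \<cdot>\<^sub>v x) y = cnj a * h x y"
  using h_smult_right[of y x a] by (simp flip: cnj_h[of y])

lemma h_zero [simp]: "x \<in> V \<Longrightarrow> h x (0\<^sub>v d) = 0" "x \<in> V \<Longrightarrow> h (0\<^sub>v d) x = 0"
  by (simp_all add: h_def)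

lemma h_selfadjoint:
  assumes M: "quat_selfadjoint N H M" and x: "x \<in> V" and y: "y \<in> V"
  shows "h (M *\<^sub>v x) y = h x (M *\<^sub>v y)"
proof -
  have cM: "M \<in> carrier_mat d d" and HM: "H * M = mat_adjoint M * H"
    using M by (auto simp: quat_selfadjoint_def Omega_carrier H_selfadjoint_def)
  have "h (M *\<^sub>v x) y = (H * M *\<^sub>v y) \<bullet>c x" unfolding HM by (rule h_mult_mat_left[OF cM x y])
  thus ?thesis using cM y by (simp add: h_def mult_mat_vec_assoc)
qed

lemma h_J_J:
  assumes x: "x \<in> V" and y: "y \<in> V"
  shows "h (J x) (J y) = cnj (h x y)"
proof -
  let ?P = "quat_mat N" and ?z = "conjugate (H *\<^sub>v y)"
  have z: "?z \<in> V" by simp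
  have "h (J x) (J y) = (?P *\<^sub>v ?z) \<bullet>c (?P *\<^sub>v conjugate x)"
    unfolding h_def Omega_mult_vec_quat_conj[OF H_Omega y] by (simp add: quat_conj_def)
  also have "\<dots> = (mat_adjoint ?P *\<^sub>v (?P *\<^sub>v ?z)) \<bullet>c conjugate x"
    by (rule cscalar_prod_mat_adjoint) (use x z in auto)
  also have "mat_adjoint ?P *\<^sub>v (?P *\<^sub>v ?z) = - (?P * ?P) *\<^sub>v ?z"
    using z by (simp add: mat_adjoint_quat_mat flip: mult_mat_vec_assoc)
  also have "\<dots> = ?z" using z by (simp add: quat_mat_square)
  also have "?z \<bullet>c conjugate x = cnj (h x y)"
    unfolding h_def using x y by (auto simp: scalar_prod_def)
  finally show ?thesis .
qed

lemma \<omega>_skew: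
  assumes x: "x \<in> V" and y: "y \<in> V"
  shows "\<omega> x y = - \<omega> y x"
proof -
  have "cnj (\<omega> x y) = h (J (J x)) (J y)" using x y by (simp add: \<omega>_def h_J_J)
  also have "\<dots> = cnj (- \<omega> y x)"
    using x y by (simp add: \<omega>_def quat_conj_quat_conj h_smult_left cnj_h)
  finally show ?thesis by (simp only: complex_cnj_cancel_iff)
qed

subsection \<open>Gram matrices and orthogonal complements\<close>

abbreviation "JM \<equiv> quat_conj_mat N"

definition gram :: "complex mat \<Rightarrow> complex mat \<Rightarrow> complex mat" where
  "gram X Y = mat_adjoint X * H * Y"

lemma gram_dim [simp]: "dim_row (gram X Y) = dim_col X" "dim_col (gram X Y) = dim_col Y"
  by (simp_all add: gram_def)

lemma index_gram:
  assumes X: "X \<in> carrier_mat d r" and Y: "Y \<in> carrier_mat d s" and ij: "i < r" "j < s"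
  shows "gram X Y $$ (i, j) = h (col X i) (col Y j)"
proof -
  have "gram X Y $$ (i, j) = row (mat_adjoint X) i \<bullet> col (H * Y) j"
    using assms by (simp add: gram_def mult_mat_assoc)
  also have "row (mat_adjoint X) i = conjugate (col X i)" using X ij by (intro eq_vecI) auto
  also have "col (H * Y) j = H *\<^sub>v col Y j" by (rule col_mult2[OF H_carrier Y ij(2)])
  also have "conjugate (col X i) \<bullet> (H *\<^sub>v col Y j) = h (col X i) (col Y j)"
    unfolding h_def using X ij by (intro comm_scalar_prod[of _ d]) auto
  finally show ?thesis .
qed

lemma mat_adjoint_gram:
  assumes "dim_row X = d" "dim_row Y = d"
  shows "mat_adjoint (gram X Y) = gram Y X"
  using assms H_hermitian by (simp add: gram_def hermitian_mat_def mat_adjoint_mult mult_mat_assoc)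

lemma gram_JM_JM:
  assumes X: "X \<in> carrier_mat d r" and Y: "Y \<in> carrier_mat d s"
  shows "gram (JM X) (JM Y) = map_mat cnj (gram X Y)"
proof (rule eq_matI)
  have J: "JM X \<in> carrier_mat d r" "JM Y \<in> carrier_mat d s" using X Y by auto
  fix i j assume "i < dim_row (map_mat cnj (gram X Y))" "j < dim_col (map_mat cnj (gram X Y))"
  hence "i < r" "j < s" using X Y by auto
  thus "gram (JM X) (JM Y) $$ (i, j) = map_mat cnj (gram X Y) $$ (i, j)"
    using X Y by (simp add: index_gram[OF J] index_gram[OF X Y] col_quat_conj_mat h_J_J)
qed (use X Y in auto)

lemma gram_JM_skew:
  assumes X: "X \<in> carrier_mat d r" and Y: "Y \<in> carrier_mat d s"
  shows "gram (JM X) Y = - transpose_mat (gram (JM Y) X)"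
proof (rule eq_matI)
  have J: "JM X \<in> carrier_mat d r" "JM Y \<in> carrier_mat d s" using X Y by auto
  fix i j assume "i < dim_row (- transpose_mat (gram (JM Y) X))"
    and "j < dim_col (- transpose_mat (gram (JM Y) X))"
  hence "i < r" "j < s" using X Y by auto
  thus "gram (JM X) Y $$ (i, j) = (- transpose_mat (gram (JM Y) X)) $$ (i, j)"
    using X Y \<omega>_skew[of "col X i" "col Y j"]
    by (simp add: index_gram[OF J(1) Y] index_gram[OF J(2) X] col_quat_conj_mat \<omega>_def)
qed (use X Y in auto)

lemma gram_hcat:
  assumes X: "X \<in> carrier_mat d a" and Y: "Y \<in> carrier_mat d b"
    and X': "X' \<in> carrier_mat d a'" and Y': "Y' \<in> carrier_mat d b'"
  shows "gram (hcat X Y) (hcat X' Y') = four_block_mat (gram X X') (gram X Y') (gram Y X') (gram Y Y')"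
proof (rule eq_matI)
  fix i j assume "i < dim_row (four_block_mat (gram X X') (gram X Y') (gram Y X') (gram Y Y'))"
    "j < dim_col (four_block_mat (gram X X') (gram X Y') (gram Y X') (gram Y Y'))"
  hence ij: "i < a + b" "j < a' + b'" using assms by auto
  show "gram (hcat X Y) (hcat X' Y') $$ (i, j) =
      four_block_mat (gram X X') (gram X Y') (gram Y X') (gram Y Y') $$ (i, j)"
    unfolding index_gram[OF hcat_carrier[OF X Y] hcat_carrier[OF X' Y'] ij]
    using assms ij
    by (auto simp: col_hcat[OF X Y] col_hcat[OF X' Y'] index_gram[OF X X'] index_gram[OF X Y']
        index_gram[OF Y X'] index_gram[OF Y Y'])
qed (use assms in \<open>auto simp: hcat_def\<close>)

lemma gram_quat_completion:
  assumes U: "U \<in> carrier_mat d r" and Q: "gram U U = Q" and isotropic: "gram (JM U) U = 0\<^sub>m r r"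
  shows "gram (quat_completion N U) (quat_completion N U) = block_diag Q (map_mat cnj Q)"
proof -
  have JU: "JM U \<in> carrier_mat d r" using U by auto
  have "gram U (JM U) = mat_adjoint (gram (JM U) U)" using U by (simp add: mat_adjoint_gram)
  also have "\<dots> = 0\<^sub>m r r" unfolding isotropic by (rule eq_matI) auto
  finally show ?thesis
    unfolding quat_completion_def gram_hcat[OF U JU U JU] gram_JM_JM[OF U U] isotropic Q block_diag_def
    using U by (simp flip: Q)
qed

definition orth :: "complex mat \<Rightarrow> complex vec set" where
  "orth S = {x \<in> V. \<forall>a \<in> carrier_vec (dim_col S). h (S *\<^sub>v a) x = 0}"

lemma orth_carrier: "x \<in> orth S \<Longrightarrow> x \<in> V"
  by (simp add: orth_def)

lemma orthD: "x \<in> orth S \<Longrightarrow> a \<in> carrier_vec (dim_col S) \<Longrightarrow> h (S *\<^sub>v a) x = 0"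
  by (simp add: orth_def)

lemma orth_col:
  assumes S: "S \<in> carrier_mat d r" and i: "i < r" and x: "x \<in> orth S"
  shows "h (col S i) x = 0"
proof -
  have "S *\<^sub>v unit_vec r i = col S i" using S i by simp
  thus ?thesis using orthD[OF x, of "unit_vec r i"] S by simp
qed

lemma gram_eq_0_of_orth:
  assumes X: "X \<in> carrier_mat d r" and Y: "Y \<in> carrier_mat d s"
    and orth: "\<And>j. j < s \<Longrightarrow> col Y j \<in> orth (quat_completion N X)"
  shows "gram X Y = 0\<^sub>m r s" "gram (JM X) Y = 0\<^sub>m r s"
proof -
  have J: "JM X \<in> carrier_mat d r" using X by auto
  note S = quat_completion_carrier[OF X]
  have "col (quat_completion N X) i = col X i" "col (quat_completion N X) (i + r) = col (JM X) i"
    if "i < r" for i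
    using that by (simp_all add: quat_completion_def col_hcat[OF X J])
  hence "h (col X i) (col Y j) = 0" "h (col (JM X) i) (col Y j) = 0" if "i < r" "j < s" for i j
    using that orth_col[OF S _ orth, of i j] orth_col[OF S _ orth, of "i + r" j] by simp_all
  thus "gram X Y = 0\<^sub>m r s" "gram (JM X) Y = 0\<^sub>m r s"
    using X Y by (auto simp: index_gram[OF X Y] index_gram[OF J Y] intro!: eq_matI)
qed

lemma orth_closed_add: "x \<in> orth S \<Longrightarrow> y \<in> orth S \<Longrightarrow> dim_row S = d \<Longrightarrow> x + y \<in> orth S"
  by (simp add: orth_def h_add_right)

lemma orth_closed_smult: "x \<in> orth S \<Longrightarrow> dim_row S = d \<Longrightarrow> a \<cdot>\<^sub>v x \<in> orth S"
  by (simp add: orth_def h_smult_right)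

lemma orth_closed_selfadjoint:
  assumes M: "quat_selfadjoint N H M" and S: "S \<in> carrier_mat d r" and C: "C \<in> carrier_mat r r"
    and MS: "M * S = S * C" and x: "x \<in> orth S"
  shows "M *\<^sub>v x \<in> orth S"
  unfolding orth_def
proof (intro CollectI conjI ballI)
  note cM = quat_selfadjoint_carrier[OF M]
  show "M *\<^sub>v x \<in> V" using cM by simp
  fix a :: "complex vec" assume a: "a \<in> carrier_vec (dim_col S)"
  have "h (S *\<^sub>v a) (M *\<^sub>v x) = h (M *\<^sub>v (S *\<^sub>v a)) x"
    using S by (simp add: h_selfadjoint[OF M] orth_carrier[OF x])
  also have "M *\<^sub>v (S *\<^sub>v a) = S *\<^sub>v (C *\<^sub>v a)"
  proof -
    have "M *\<^sub>v (S *\<^sub>v a) = M * S *\<^sub>v a" using cM S a by (simp add: mult_mat_vec_assoc)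
    thus ?thesis using S C a by (simp add: MS mult_mat_vec_assoc)
  qed
  also have "h (S *\<^sub>v (C *\<^sub>v a)) x = 0" using S C by (intro orthD[OF x]) simp
  finally show "h (S *\<^sub>v a) (M *\<^sub>v x) = 0" .
qed

lemma orth_closed_J:
  assumes S: "S \<in> carrier_mat d r" and C: "C \<in> carrier_mat r r" and JS: "JM S = S * C" and x: "x \<in> orth S"
  shows "J x \<in> orth S"
  unfolding orth_def
proof (intro CollectI conjI ballI)
  show "J x \<in> V" by simp
  fix a :: "complex vec" assume a: "a \<in> carrier_vec (dim_col S)"
  have "J (S *\<^sub>v a) = JM S *\<^sub>v conjugate a"
    using S a by (simp add: quat_conj_def quat_conj_mat_def conjugate_mult_mat_vec mult_mat_vec_assoc)
  also have "\<dots> = S *\<^sub>v (C *\<^sub>v conjugate a)" using S C a by (simp add: JS mult_mat_vec_assoc)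
  finally have "h (J (S *\<^sub>v a)) x = 0" using S C by (simp add: orthD[OF x])
  moreover have "h (S *\<^sub>v a) (J x) = cnj (h (J (S *\<^sub>v a)) (J (J x)))" using S by (simp add: h_J_J)
  ultimately show "h (S *\<^sub>v a) (J x) = 0"
    using orth_carrier[OF x] by (simp add: quat_conj_quat_conj h_smult_right)
qed

context
  fixes S G :: "complex mat" and r :: nat
  assumes S: "S \<in> carrier_mat d r" and gram: "gram S S = G" and involution: "G * G = 1\<^sub>m r"
begin

definition coefficients :: "complex mat" where "coefficients = G * (mat_adjoint S * H)"

lemma G_dim: "dim_row G = r" "dim_col G = r"
  using S by (auto simp flip: gram)

lemma coefficients_carrier: "coefficients \<in> carrier_mat r d"
  by (intro carrier_matI) (simp_all add: coefficients_def G_dim)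

lemma coefficients_left_inverse: "coefficients * S = 1\<^sub>m r"
proof -
  have "coefficients * S = G * gram S S"
    using S by (simp add: coefficients_def gram_def mult_mat_assoc G_dim)
  thus ?thesis by (simp add: gram involution)
qed

lemma diff_projection_orth:
  assumes y: "y \<in> V"
  shows "y - S *\<^sub>v (coefficients *\<^sub>v y) \<in> orth S"
  unfolding orth_def
proof (intro CollectI conjI ballI)
  let ?A = "mat_adjoint S * H"
  have A: "?A \<in> carrier_mat r d" using S by (intro carrier_matI) simp_all
  show diff: "y - S *\<^sub>v (coefficients *\<^sub>v y) \<in> V" using y S by simp
  fix a :: "complex vec" assume a: "a \<in> carrier_vec (dim_col S)"
  have "?A *\<^sub>v (S *\<^sub>v (coefficients *\<^sub>v y)) = gram S S *\<^sub>v (coefficients *\<^sub>v y)"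
    using S coefficients_carrier by (simp add: gram_def flip: mult_mat_vec_assoc)
  also have "\<dots> = G * G *\<^sub>v (?A *\<^sub>v y)"
    using S y by (simp add: gram coefficients_def G_dim mult_mat_vec_assoc)
  also have "\<dots> = ?A *\<^sub>v y" using S by (simp add: involution)
  finally have "?A *\<^sub>v (y - S *\<^sub>v (coefficients *\<^sub>v y)) = 0\<^sub>v r"
    using S y A by (simp add: mult_minus_distrib_mat_vec[OF A y])
  thus "h (S *\<^sub>v a) (y - S *\<^sub>v (coefficients *\<^sub>v y)) = 0"
    using S a by (subst h_mult_mat_left[OF S _ diff]) simp_all
qed

lemma coefficients_right_inverse:
  assumes trivial: "orth S \<subseteq> {0\<^sub>v d}"
  shows "S * coefficients = 1\<^sub>m d"
proof (rule mat_col_eqI)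
  fix j assume "j < dim_col (1\<^sub>m d :: complex mat)"
  hence j: "j < d" by simp
  let ?e = "unit_vec d j :: complex vec"
  have X: "dim_col coefficients = d" "dim_row coefficients = r" using coefficients_carrier by auto
  have "?e - S *\<^sub>v (coefficients *\<^sub>v ?e) = 0\<^sub>v d"
    using diff_projection_orth[of ?e] trivial by auto
  hence "S *\<^sub>v (coefficients *\<^sub>v ?e) = ?e"
    using S by (auto simp: vec_eq_iff simp del: index_mult_mat_vec mult_mat_unit_vec)
  moreover have "col (S * coefficients) j = S * coefficients *\<^sub>v ?e" using j S X by simp
  ultimately show "col (S * coefficients) j = col (1\<^sub>m d) j"
    using j S X by (simp add: mult_mat_vec_assoc del: mult_mat_unit_vec)
qed (use S coefficients_carrier in auto)

lemma orth_radical: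
  assumes x: "x \<in> orth S" and radical: "\<And>y. y \<in> orth S \<Longrightarrow> h x y = 0"
  shows "H *\<^sub>v x = 0\<^sub>v d"
proof -
  note xV = orth_carrier[OF x]
  have "h y x = 0" if y: "y \<in> V" for y
  proof -
    let ?s = "S *\<^sub>v (coefficients *\<^sub>v y)"
    have s: "?s \<in> V" and diff: "y - ?s \<in> V" using S y by simp_all
    have "h (y - ?s) x = cnj (h x (y - ?s))" by (simp add: cnj_h xV diff)
    also have "\<dots> = 0" by (simp add: radical diff_projection_orth[OF y])
    finally have "h (y - ?s + ?s) x = 0"
      using S coefficients_carrier by (simp only: h_add_left[OF diff s xV]) (simp add: orthD[OF x])
    moreover have "y - ?s + ?s = y" using y s by (auto intro!: eq_vecI simp del: index_mult_mat_vec)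
    ultimately show ?thesis by simp
  qed
  from this[of "H *\<^sub>v x"] have "(H *\<^sub>v x) \<bullet>c (H *\<^sub>v x) = 0" by (simp add: h_def)
  thus ?thesis using conjugate_square_eq_0_vec[of "H *\<^sub>v x" d] by simp
qed

end

end

section \<open>Complex structures\<close>

locale quat_complex_structure = quaternionic_form +
  fixes B K :: "complex mat"
  assumes B_sa: "quat_selfadjoint N H B" and K: "complex_structure N H B K"
    and H_invertible: "invertible_mat H" and real_spectrum: "spectrum_mat B \<subseteq> \<real>"
begin

definition polyB :: "complex poly \<Rightarrow> complex vec \<Rightarrow> complex vec" where "polyB p x = poly_mat B p *\<^sub>v x"

lemma B_carrier [simp]: "B \<in> carrier_mat d d"
  by (rule quat_selfadjoint_carrier[OF B_sa])

lemma K_sa: "quat_selfadjoint N H K"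
  using K by (simp add: complex_structure_def)

lemma K_carrier [simp]: "K \<in> carrier_mat d d"
  by (rule quat_selfadjoint_carrier[OF K_sa])

lemma K_square: "x \<in> V \<Longrightarrow> K *\<^sub>v (K *\<^sub>v x) = (- 1) \<cdot>\<^sub>v x"
  using K carrier_matD[OF K_carrier]
  by (auto simp: complex_structure_def simp flip: mult_mat_vec_assoc intro!: eq_vecI)

lemma K_J: "x \<in> V \<Longrightarrow> K *\<^sub>v J x = J (K *\<^sub>v x)"
  using K_sa by (intro Omega_mult_vec_quat_conj) (auto simp: quat_selfadjoint_def)

lemma B_J: "x \<in> V \<Longrightarrow> B *\<^sub>v J x = J (B *\<^sub>v x)"
  using B_sa by (intro Omega_mult_vec_quat_conj) (auto simp: quat_selfadjoint_def)

lemma B_dim [simp]: "dim_row B = d" "dim_col B = d"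
  using B_carrier by blast+

lemma K_dim [simp]: "dim_row K = d" "dim_col K = d"
  using K_carrier by blast+

lemma polyB_closed [simp]: "polyB p x \<in> V"
  by (simp add: polyB_def poly_mat_dim[OF B_carrier])

lemma polyB_pCons: "x \<in> V \<Longrightarrow> polyB (pCons a p) x = a \<cdot>\<^sub>v x + B *\<^sub>v polyB p x"
  unfolding polyB_def poly_mat_pCons[OF B_carrier]
  by (subst add_mult_distrib_mat_vec[of _ d d])
    (auto simp: poly_mat_dim[OF B_carrier] mult_mat_vec_assoc smult_one_mult_vec)

lemma polyB_mult: "x \<in> V \<Longrightarrow> polyB (p * q) x = polyB p (polyB q x)"
  unfolding polyB_def
  by (simp add: poly_mat_mult[OF B_carrier] poly_mat_dim[OF B_carrier] mult_mat_vec_assoc)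

lemma polyB_add: "x \<in> V \<Longrightarrow> polyB (p + q) x = polyB p x + polyB q x"
  unfolding polyB_def poly_mat_add[OF B_carrier]
  by (rule add_mult_distrib_mat_vec[OF poly_mat_carrier[OF B_carrier] poly_mat_carrier[OF B_carrier]])

lemma polyB_const: "x \<in> V \<Longrightarrow> polyB [:a:] x = a \<cdot>\<^sub>v x"
  by (simp add: polyB_def poly_mat_const[OF B_carrier] smult_one_mult_vec)

lemma polyB_0 [simp]: "x \<in> V \<Longrightarrow> polyB 0 x = 0\<^sub>v d"
  using polyB_const[of x 0] by (simp add: smult_vec_eq_0_iff)

lemma polyB_smult: "x \<in> V \<Longrightarrow> polyB (Polynomial.smult a p) x = a \<cdot>\<^sub>v polyB p x"
  using polyB_mult[of x "[:a:]" p] by (simp add: polyB_const)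

lemma polyB_vec_add: "x \<in> V \<Longrightarrow> y \<in> V \<Longrightarrow> polyB p (x + y) = polyB p x + polyB p y"
  unfolding polyB_def by (rule mult_add_distrib_mat_vec[OF poly_mat_carrier[OF B_carrier]])

lemma polyB_vec_smult: "x \<in> V \<Longrightarrow> polyB p (a \<cdot>\<^sub>v x) = a \<cdot>\<^sub>v polyB p x"
  unfolding polyB_def by (rule mult_mat_vec[OF poly_mat_carrier[OF B_carrier]])

lemma polyB_vec_zero [simp]: "polyB p (0\<^sub>v d) = 0\<^sub>v d"
  by (simp add: polyB_def poly_mat_dim[OF B_carrier])

lemma B_polyB: "x \<in> V \<Longrightarrow> B *\<^sub>v x = polyB [:- a, 1:] x + a \<cdot>\<^sub>v x"
  by (auto simp: polyB_pCons intro!: eq_vecI simp del: index_mult_mat_vec)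

lemma polyB_B: "x \<in> V \<Longrightarrow> polyB p (B *\<^sub>v x) = B *\<^sub>v polyB p x"
  using poly_mat_commute[OF B_carrier B_carrier refl, of p]
  by (simp add: polyB_def poly_mat_dim[OF B_carrier] flip: mult_mat_vec_assoc)

lemma polyB_K: "x \<in> V \<Longrightarrow> polyB p (K *\<^sub>v x) = K *\<^sub>v polyB p x"
  using poly_mat_commute[OF B_carrier K_carrier, of p] K
  by (simp add: polyB_def complex_structure_def poly_mat_dim[OF B_carrier] flip: mult_mat_vec_assoc)

lemma polyB_cnj_J: "x \<in> V \<Longrightarrow> polyB (map_poly cnj p) (J x) = J (polyB p x)"
  by (induction p) (simp_all add: polyB_pCons hom_distribs B_J quat_conj_add quat_conj_smult)

lemma h_polyB_left: "x \<in> V \<Longrightarrow> y \<in> V \<Longrightarrow> h (polyB p x) y = h x (polyB (map_poly cnj p) y)"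
proof (induction p arbitrary: y)
  case (pCons a p)
  thus ?case
    by (simp add: polyB_pCons hom_distribs h_add_left h_add_right h_smult_left h_smult_right
        h_selfadjoint[OF B_sa] polyB_B)
qed simp

lemma h_polyB_sum:
  "x \<in> V \<Longrightarrow> y \<in> V \<Longrightarrow> h x (polyB (sum p I) y) = (\<Sum>i\<in>I. h x (polyB (p i) y))"
  by (induction I rule: infinite_finite_induct) (simp_all add: polyB_add h_add_right)

lemma \<omega>_polyB_left: "x \<in> V \<Longrightarrow> y \<in> V \<Longrightarrow> \<omega> (polyB p x) y = \<omega> x (polyB p y)"
proof -
  assume "x \<in> V" "y \<in> V"
  moreover have "map_poly cnj (map_poly cnj p) = p" by (simp add: map_poly_map_poly comp_def)
  ultimately show ?thesis using h_polyB_left[of "J x" y "map_poly cnj p"] by (simp add: \<omega>_def polyB_cnj_J)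
qed

lemma \<omega>_polyB_self: "x \<in> V \<Longrightarrow> \<omega> x (polyB p x) = 0"
  using \<omega>_skew[of x "polyB p x"] \<omega>_polyB_left[of x x p] by simp

definition K_eigenspace :: "complex vec set" where "K_eigenspace = {x \<in> V. K *\<^sub>v x = \<i> \<cdot>\<^sub>v x}"

lemma K_eigenspaceD: "x \<in> K_eigenspace \<Longrightarrow> x \<in> V" "x \<in> K_eigenspace \<Longrightarrow> K *\<^sub>v x = \<i> \<cdot>\<^sub>v x"
  by (simp_all add: K_eigenspace_def)

lemma K_eigenspace_isotropic:
  assumes "x \<in> K_eigenspace" "y \<in> K_eigenspace"
  shows "h x y = 0"
proof -
  have "- \<i> * h x y = \<i> * h x y"
    using assms h_selfadjoint[OF K_sa, of x y]
    by (simp add: K_eigenspace_def h_smult_left h_smult_right)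
  thus ?thesis by (simp add: complex_eq_iff)
qed

lemma K_eigenspace_polyB: "x \<in> K_eigenspace \<Longrightarrow> polyB p x \<in> K_eigenspace"
  by (simp add: K_eigenspace_def polyB_vec_smult flip: polyB_K)

lemma K_eigenspace_projection:
  "x \<in> V \<Longrightarrow> x + (- \<i>) \<cdot>\<^sub>v (K *\<^sub>v x) \<in> K_eigenspace"
  by (auto simp: K_eigenspace_def mult_add_distrib_mat_vec[OF K_carrier] mult_mat_vec[OF K_carrier]
      K_square algebra_simps intro!: eq_vecI simp del: index_mult_mat_vec)

lemma K_eigenspace_J_projection:
  assumes x: "x \<in> V"
  shows "J (x + \<i> \<cdot>\<^sub>v (K *\<^sub>v x)) \<in> K_eigenspace"
proof -
  have "K *\<^sub>v (x + \<i> \<cdot>\<^sub>v (K *\<^sub>v x)) = (- \<i>) \<cdot>\<^sub>v (x + \<i> \<cdot>\<^sub>v (K *\<^sub>v x))"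
    using x
    by (auto simp: mult_add_distrib_mat_vec[OF K_carrier] mult_mat_vec[OF K_carrier] K_square
        algebra_simps intro!: eq_vecI simp del: index_mult_mat_vec)
  thus ?thesis using x by (simp add: K_eigenspace_def K_J quat_conj_smult)
qed

definition invariant :: "complex vec set \<Rightarrow> bool" where
  "invariant W \<longleftrightarrow> W \<subseteq> V \<and> (\<forall>x\<in>W. \<forall>y\<in>W. x + y \<in> W) \<and> (\<forall>x\<in>W. \<forall>a. a \<cdot>\<^sub>v x \<in> W) \<and>
     (\<forall>x\<in>W. B *\<^sub>v x \<in> W \<and> K *\<^sub>v x \<in> W \<and> J x \<in> W)"

definition nondegenerate :: "complex vec set \<Rightarrow> bool" where
  "nondegenerate W \<longleftrightarrow> (\<forall>x\<in>W. (\<forall>y\<in>W. h x y = 0) \<longrightarrow> x = 0\<^sub>v d)"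

lemma invariantD:
  assumes "invariant W" "x \<in> W"
  shows "x \<in> V" "y \<in> W \<Longrightarrow> x + y \<in> W" "a \<cdot>\<^sub>v x \<in> W" "B *\<^sub>v x \<in> W" "K *\<^sub>v x \<in> W" "J x \<in> W"
  using assms by (auto simp: invariant_def)

lemma invariant_polyB:
  assumes W: "invariant W" and x: "x \<in> W"
  shows "polyB p x \<in> W"
proof (induction p)
  case 0
  show ?case using invariantD(1)[OF W x] invariantD(3)[OF W x, of 0] by simp
next
  case (pCons a p)
  thus ?case using invariantD[OF W] x by (simp add: polyB_pCons)
qed

lemma invariant_meets_K_eigenspace:
  assumes W: "invariant W" and x: "x \<in> W" "x \<noteq> 0\<^sub>v d"
  shows "\<exists>y \<in> W \<inter> K_eigenspace. y \<noteq> 0\<^sub>v d"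
proof (rule ccontr)
  assume trivial: "\<not> ?thesis"
  note xV = invariantD(1)[OF W x(1)]
  have "x + (- \<i>) \<cdot>\<^sub>v (K *\<^sub>v x) \<in> W" "J (x + \<i> \<cdot>\<^sub>v (K *\<^sub>v x)) \<in> W"
    using invariantD[OF W] x(1) by simp_all
  hence "x + (- \<i>) \<cdot>\<^sub>v (K *\<^sub>v x) = 0\<^sub>v d" "J (x + \<i> \<cdot>\<^sub>v (K *\<^sub>v x)) = 0\<^sub>v d"
    using trivial K_eigenspace_projection[OF xV] K_eigenspace_J_projection[OF xV] by blast+
  moreover from this(2) have "x + \<i> \<cdot>\<^sub>v (K *\<^sub>v x) = 0\<^sub>v d"
    using xV by (subst (asm) quat_conj_eq_0_iff) simp_all
  ultimately have "(x + (- \<i>) \<cdot>\<^sub>v (K *\<^sub>v x)) + (x + \<i> \<cdot>\<^sub>v (K *\<^sub>v x)) = 0\<^sub>v d" by simp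
  moreover have "(x + (- \<i>) \<cdot>\<^sub>v (K *\<^sub>v x)) + (x + \<i> \<cdot>\<^sub>v (K *\<^sub>v x)) = 2 \<cdot>\<^sub>v x"
    using xV by (auto intro!: eq_vecI simp del: index_mult_mat_vec)
  ultimately show False using x(2) by (simp add: smult_vec_eq_0_iff)
qed

lemma K_eigenspace_\<omega>_nondegenerate:
  assumes W: "invariant W" "nondegenerate W" and z: "z \<in> W \<inter> K_eigenspace" "z \<noteq> 0\<^sub>v d"
  shows "\<exists>y \<in> W \<inter> K_eigenspace. \<omega> z y \<noteq> 0"
proof -
  have zV: "z \<in> V" "K *\<^sub>v z = \<i> \<cdot>\<^sub>v z" using z K_eigenspaceD by auto
  have "J z \<in> W" "J z \<noteq> 0\<^sub>v d" using z zV invariantD[OF W(1)] by (auto simp: quat_conj_eq_0_iff)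
  then obtain y where y: "y \<in> W" "h (J z) y \<noteq> 0" using W(2) by (auto simp: nondegenerate_def)
  note yV = invariantD(1)[OF W(1) y(1)]
  have "h (J z) (K *\<^sub>v y) = \<i> * h (J z) y"
    using zV yV by (simp add: K_J quat_conj_smult h_smult_left flip: h_selfadjoint[OF K_sa])
  hence "\<omega> z (y + (- \<i>) \<cdot>\<^sub>v (K *\<^sub>v y)) = 2 * h (J z) y"
    using yV by (simp add: \<omega>_def h_add_right h_smult_right)
  moreover have "y + (- \<i>) \<cdot>\<^sub>v (K *\<^sub>v y) \<in> W \<inter> K_eigenspace"
    using y(1) invariantD[OF W(1)] K_eigenspace_projection[OF yV] by simp
  ultimately show ?thesis using y(2) by (intro bexI[of _ "y + (- \<i>) \<cdot>\<^sub>v (K *\<^sub>v y)"]) auto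
qed

definition lin_factor :: "real \<Rightarrow> complex poly" where "lin_factor l = [:- complex_of_real l, 1:]"

lemma cnj_lin_factor_power: "map_poly cnj (lin_factor l ^ k) = lin_factor l ^ k"
  by (simp add: lin_factor_def hom_distribs)

lemma polyB_eigen:
  assumes x: "x \<in> V" and "polyB [:- a, 1:] x = 0\<^sub>v d"
  shows "polyB r x = poly r a \<cdot>\<^sub>v x"
proof -
  have "r = [:poly r a:] + synthetic_div r a * [:- a, 1:]"
    using synthetic_div_correct'[of a r] by (simp add: algebra_simps)
  hence "polyB r x = polyB [:poly r a:] x + polyB (synthetic_div r a) (polyB [:- a, 1:] x)"
    using x polyB_add polyB_mult by metis
  thus ?thesis using assms by (simp add: polyB_const)
qed

lemma ex_minimal_annihilator:
  assumes W: "invariant W" and w: "w \<in> W" "w \<noteq> 0\<^sub>v d"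
  obtains p where "degree p > 0" "\<And>x. x \<in> W \<inter> K_eigenspace \<Longrightarrow> polyB p x = 0\<^sub>v d"
    "\<And>q. q \<noteq> 0 \<Longrightarrow> degree q < degree p \<Longrightarrow> \<exists>x \<in> W \<inter> K_eigenspace. polyB q x \<noteq> 0\<^sub>v d"
proof -
  define annihilates where "annihilates p \<longleftrightarrow> p \<noteq> 0 \<and> (\<forall>x \<in> W \<inter> K_eigenspace. polyB p x = 0\<^sub>v d)" for p
  have "char_poly B \<noteq> 0" using degree_monic_char_poly[OF B_carrier] by auto
  hence "annihilates (char_poly B)"
    using cayley_hamilton[OF B_carrier] K_eigenspaceD(1) by (auto simp: annihilates_def polyB_def)
  then obtain p where p: "annihilates p" and minimal: "\<And>q. degree q < degree p \<Longrightarrow> \<not> annihilates q"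
    using ex_has_least_nat[of annihilates _ degree] by (metis not_le)
  obtain y where y: "y \<in> W \<inter> K_eigenspace" "y \<noteq> 0\<^sub>v d"
    using invariant_meets_K_eigenspace[OF W w] by blast
  have "degree p \<noteq> 0"
  proof
    assume "degree p = 0"
    then obtain c where "p = [:c:]" by (elim degree_eq_zeroE)
    moreover have "polyB p y = 0\<^sub>v d" using p y(1) by (simp add: annihilates_def)
    ultimately show False
      using p y K_eigenspaceD(1)[of y] by (auto simp: annihilates_def polyB_const smult_vec_eq_0_iff)
  qed
  thus thesis using that[of p] p minimal unfolding annihilates_def by blast
qed

lemma ex_maximal_chain:
  assumes W: "invariant W" and w: "w \<in> W" "w \<noteq> 0\<^sub>v d"
  shows "\<exists>l k r. eigenvalue B (complex_of_real l) \<and> poly r (complex_of_real l) \<noteq> 0 \<and>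
    (\<exists>x \<in> W \<inter> K_eigenspace. polyB (lin_factor l ^ k * r) x \<noteq> 0\<^sub>v d) \<and>
    (\<forall>x \<in> W \<inter> K_eigenspace. polyB (lin_factor l ^ Suc k * r) x = 0\<^sub>v d)"
proof -
  obtain p where degree: "degree p > 0" and p: "\<And>x. x \<in> W \<inter> K_eigenspace \<Longrightarrow> polyB p x = 0\<^sub>v d"
    and minimal: "\<And>q. q \<noteq> 0 \<Longrightarrow> degree q < degree p \<Longrightarrow> \<exists>x \<in> W \<inter> K_eigenspace. polyB q x \<noteq> 0\<^sub>v d"
    using ex_minimal_annihilator[OF W w] by metis
  obtain a where a: "poly p a = 0"
    using fundamental_theorem_of_algebra[of p] degree by (auto simp: constant_degree)
  define n where "n = [:- a, 1:]"
  have nonzero: "p \<noteq> 0" using degree by auto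
  hence "Polynomial.order a p \<noteq> 0" using a by (simp add: order_root)
  then obtain k where k: "Polynomial.order a p = Suc k" using not0_implies_Suc by blast
  obtain r where r: "p = n ^ Suc k * r" "\<not> n dvd r"
    using order_decomp[OF nonzero, of a] k unfolding n_def by auto
  have p_factor: "p = n * (n ^ k * r)" by (simp add: r(1) mult.assoc)
  moreover have "n ^ k * r \<noteq> 0" using nonzero r(1) by auto
  ultimately obtain x where x: "x \<in> W \<inter> K_eigenspace" "polyB (n ^ k * r) x \<noteq> 0\<^sub>v d"
    using minimal[of "n ^ k * r"] degree_mult_eq[of n "n ^ k * r"] by (auto simp: n_def)
  have "polyB n (polyB (n ^ k * r) x) = polyB p x"
    using x(1) K_eigenspaceD(1) p_factor by (simp flip: polyB_mult)
  hence "eigenvector B (polyB (n ^ k * r) x) a"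
    using p[OF x(1)] x(2) B_polyB[of "polyB (n ^ k * r) x" a] by (simp add: eigenvector_def n_def)
  hence eigen: "eigenvalue B a" by (auto simp: eigenvalue_def)
  then obtain l where "a = complex_of_real l"
    using real_spectrum by (auto simp: spectrum_mat_def Reals_def)
  thus ?thesis
    using eigen p x r unfolding n_def lin_factor_def poly_eq_0_iff_dvd by blast
qed

definition dual_chains :: "real \<Rightarrow> nat \<Rightarrow> complex vec \<Rightarrow> complex vec \<Rightarrow> bool" where
  "dual_chains l k e f \<longleftrightarrow> e \<in> K_eigenspace \<and> f \<in> K_eigenspace \<and>
     polyB (lin_factor l ^ Suc k) e = 0\<^sub>v d \<and> polyB (lin_factor l ^ Suc k) f = 0\<^sub>v d \<and>
     (\<forall>t. \<omega> e (polyB (lin_factor l ^ t) f) = (if t = k then 1 else 0))"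

lemma dual_chains_normalize:
  assumes e: "e \<in> K_eigenspace" "polyB (lin_factor l ^ Suc k) e = 0\<^sub>v d"
    and f: "f \<in> K_eigenspace" "polyB (lin_factor l ^ Suc k) f = 0\<^sub>v d"
    and "\<omega> e (polyB (lin_factor l ^ k) f) \<noteq> 0"
  obtains s where "dual_chains l k e (polyB s f)"
proof -
  note V = e(1)[THEN K_eigenspaceD(1)] f(1)[THEN K_eigenspaceD(1)]
  have "\<omega> e (polyB (lin_factor l ^ t) f) = 0" if "t > k" for t
  proof -
    have "lin_factor l ^ t = lin_factor l ^ (t - Suc k) * lin_factor l ^ Suc k"
      using that by (metis Suc_leI le_add_diff_inverse2 power_add)
    thus ?thesis using V f(2) by (simp add: polyB_mult \<omega>_def del: power_Suc)
  qed
  then obtain a where a: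
    "\<And>t. (\<Sum>j\<le>k. a j * \<omega> e (polyB (lin_factor l ^ (t + j)) f)) = (if t = k then 1 else 0)"
    using ex_dual_coefficients[of "\<lambda>t. \<omega> e (polyB (lin_factor l ^ t) f)" k] assms(5) by auto
  define s where "s = (\<Sum>j\<le>k. Polynomial.smult (a j) (lin_factor l ^ j))"
  have "\<omega> e (polyB (lin_factor l ^ t) (polyB s f)) = (if t = k then 1 else 0)" for t
  proof -
    have "lin_factor l ^ t * s = (\<Sum>j\<le>k. Polynomial.smult (a j) (lin_factor l ^ (t + j)))"
      by (simp add: s_def sum_distrib_left power_add)
    hence "\<omega> e (polyB (lin_factor l ^ t) (polyB s f)) =
        (\<Sum>j\<le>k. a j * \<omega> e (polyB (lin_factor l ^ (t + j)) f))"
      using V by (simp add: \<omega>_def h_polyB_sum polyB_smult h_smult_right flip: polyB_mult)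
    thus ?thesis by (simp only: a)
  qed
  moreover have "polyB (lin_factor l ^ Suc k) (polyB s f) = 0\<^sub>v d"
    using V f(2) by (metis mult.commute polyB_mult polyB_vec_zero)
  ultimately have "dual_chains l k e (polyB s f)"
    using e f(1) by (simp add: dual_chains_def K_eigenspace_polyB)
  thus thesis by (rule that)
qed

lemma ex_dual_chains:
  assumes W: "invariant W" "nondegenerate W" and w: "w \<in> W" "w \<noteq> 0\<^sub>v d"
  obtains l k e f where "eigenvalue B (complex_of_real l)" "e \<in> W" "f \<in> W" "dual_chains l k e f"
proof -
  obtain l k r x where l: "eigenvalue B (complex_of_real l)" and rl: "poly r (complex_of_real l) \<noteq> 0"
    and x: "x \<in> W \<inter> K_eigenspace" "polyB (lin_factor l ^ k * r) x \<noteq> 0\<^sub>v d"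
    and annihilated: "\<And>y. y \<in> W \<inter> K_eigenspace \<Longrightarrow> polyB (lin_factor l ^ Suc k * r) y = 0\<^sub>v d"
    using ex_maximal_chain[OF W(1) w] by blast
  define z where "z = polyB (lin_factor l ^ k * r) x"
  have "z \<in> W \<inter> K_eigenspace"
    using x(1) invariant_polyB[OF W(1)] K_eigenspace_polyB by (simp add: z_def)
  then obtain y where y: "y \<in> W \<inter> K_eigenspace" "\<omega> z y \<noteq> 0"
    using K_eigenspace_\<omega>_nondegenerate[OF W, of z] x(2) by (auto simp: z_def)
  have V: "x \<in> V" "y \<in> V" "z \<in> V" using x(1) y(1) K_eigenspaceD(1) by (auto simp: z_def)
  have chains: "polyB (lin_factor l ^ Suc k) (polyB r x) = 0\<^sub>v d"
      "polyB (lin_factor l ^ Suc k) (polyB r y) = 0\<^sub>v d"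
    using annihilated x y V by (simp_all flip: polyB_mult)
  have "polyB (lin_factor l) z = 0\<^sub>v d"
    using annihilated[OF x(1)] V by (simp add: z_def mult.assoc flip: polyB_mult)
  hence rz: "polyB r z = poly r (complex_of_real l) \<cdot>\<^sub>v z"
    unfolding lin_factor_def by (rule polyB_eigen[OF V(3)])
  have "\<omega> (polyB r x) (polyB (lin_factor l ^ k) (polyB r y)) = \<omega> (polyB r z) y"
    using V by (simp add: z_def \<omega>_polyB_left ac_simps flip: polyB_mult)
  also have "\<dots> \<noteq> 0"
    using rl y(2) V unfolding rz by (simp add: \<omega>_def quat_conj_smult h_smult_left)
  finally obtain s where "dual_chains l k (polyB r x) (polyB s (polyB r y))"
    using dual_chains_normalize[of "polyB r x" l k "polyB r y"] x(1) y(1) chains K_eigenspace_polyB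
    by auto
  moreover have "polyB r x \<in> W" "polyB s (polyB r y) \<in> W"
    using x(1) y(1) invariant_polyB[OF W(1)] by auto
  ultimately show thesis using that l by blast
qed

subsection \<open>Frames\<close>

definition chain :: "real \<Rightarrow> nat \<Rightarrow> complex vec \<Rightarrow> complex mat" where
  "chain l k u = mat d (Suc k) (\<lambda>(i, j). polyB (lin_factor l ^ (k - j)) u $ i)"

lemma chain_carrier [simp]: "chain l k u \<in> carrier_mat d (Suc k)"
  by (simp add: chain_def)

lemma chain_dim [simp]: "dim_row (chain l k u) = d" "dim_col (chain l k u) = Suc k"
  by (simp_all add: chain_def)

lemma col_chain: "j < Suc k \<Longrightarrow> col (chain l k u) j = polyB (lin_factor l ^ (k - j)) u"
  by (intro eq_vecI) (auto simp: chain_def polyB_def poly_mat_dim[OF B_carrier])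

lemma B_mult_chain:
  assumes u: "u \<in> V" and "polyB (lin_factor l ^ Suc k) u = 0\<^sub>v d"
  shows "B * chain l k u = chain l k u * jordan_block (Suc k) (complex_of_real l)"
proof (rule mat_col_eqI)
  let ?E = "chain l k u" and ?J = "jordan_block (Suc k) (complex_of_real l)"
  fix j assume "j < dim_col (?E * ?J)"
  hence j: "j < Suc k" by simp
  have "B *\<^sub>v col ?E j = polyB (lin_factor l ^ Suc (k - j)) u + complex_of_real l \<cdot>\<^sub>v col ?E j"
    unfolding col_chain[OF j] using u
    by (subst B_polyB[of _ "complex_of_real l"]) (simp_all add: polyB_mult flip: lin_factor_def)
  also have "\<dots> = ?E *\<^sub>v col ?J j"
  proof (cases j)
    case 0
    hence "col ?J j = complex_of_real l \<cdot>\<^sub>v unit_vec (Suc k) j"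
      by (intro eq_vecI) (auto simp: jordan_block_def)
    moreover have "col ?E j \<in> V" by (intro carrier_vecI) simp
    ultimately show ?thesis using assms(2) 0 by (simp add: mult_mat_vec[OF chain_carrier] del: power_Suc)
  next
    case (Suc i)
    hence "col ?J j = unit_vec (Suc k) i + complex_of_real l \<cdot>\<^sub>v unit_vec (Suc k) j"
      using j by (intro eq_vecI) (auto simp: jordan_block_def)
    moreover have "k - i = Suc (k - j)" using Suc j by simp
    ultimately show ?thesis using j Suc
      by (simp add: mult_mat_vec[OF chain_carrier] mult_add_distrib_mat_vec[OF chain_carrier] col_chain
          del: power_Suc)
  qed
  finally show "col (B * ?E) j = col (?E * ?J) j"
    using j
    by (simp add: col_mult2[OF B_carrier chain_carrier]
        col_mult2[OF chain_carrier jordan_block_carrier])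
qed simp_all

lemma K_mult_chain:
  assumes "u \<in> V" "v \<in> V" and "K *\<^sub>v u = a \<cdot>\<^sub>v v"
  shows "K * chain l k u = a \<cdot>\<^sub>m chain l k v"
proof (rule mat_col_eqI)
  fix j assume "j < dim_col (a \<cdot>\<^sub>m chain l k v)"
  thus "col (K * chain l k u) j = col (a \<cdot>\<^sub>m chain l k v) j"
    using assms
    by (simp add: col_mult2[OF K_carrier chain_carrier] col_chain polyB_vec_smult flip: polyB_K)
qed simp_all

lemma JM_chain: "u \<in> V \<Longrightarrow> JM (chain l k u) = chain l k (J u)"
proof (rule mat_col_eqI)
  fix j assume "u \<in> V" "j < dim_col (chain l k (J u))"
  thus "col (JM (chain l k u)) j = col (chain l k (J u)) j"
    using polyB_cnj_J[of u "lin_factor l ^ (k - j)"]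
    by (simp add: col_quat_conj_mat[OF chain_carrier] col_chain cnj_lin_factor_power)
qed simp_all

lemma gram_chain:
  assumes u: "u \<in> V" and v: "v \<in> V"
    and uv: "\<And>t. h u (polyB (lin_factor l ^ t) v) = (if t = k then c else 0)"
  shows "gram (chain l k u) (chain l k v) = c \<cdot>\<^sub>m Q_mat (Suc k)"
proof (rule eq_matI)
  fix i j assume "i < dim_row (c \<cdot>\<^sub>m Q_mat (Suc k))" "j < dim_col (c \<cdot>\<^sub>m Q_mat (Suc k))"
  hence ij: "i < Suc k" "j < Suc k" by auto
  have "gram (chain l k u) (chain l k v) $$ (i, j) =
        h (polyB (lin_factor l ^ (k - i)) u) (polyB (lin_factor l ^ (k - j)) v)"
    using ij by (simp add: index_gram[OF chain_carrier chain_carrier] col_chain)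
  also have "\<dots> = h u (polyB (lin_factor l ^ (k - i + (k - j))) v)"
    using u v by (simp add: h_polyB_left cnj_lin_factor_power polyB_mult power_add)
  also have "\<dots> = (if i + j = k then c else 0)" unfolding uv using ij by auto
  finally show "gram (chain l k u) (chain l k v) $$ (i, j) = (c \<cdot>\<^sub>m Q_mat (Suc k)) $$ (i, j)"
    using ij by (simp add: Q_mat_def)
qed simp_all

definition twist :: "complex vec \<Rightarrow> complex vec \<Rightarrow> real \<Rightarrow> complex vec" where
  "twist e f a = e + complex_of_real a \<cdot>\<^sub>v J f"

context
  fixes l :: real and k :: nat and e f :: "complex vec"
  assumes dual: "dual_chains l k e f"
begin

lemma dual_chains_carrier: "e \<in> V" "f \<in> V"
  using dual K_eigenspaceD(1) by (auto simp: dual_chains_def)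

lemma twist_carrier [simp]: "twist e f a \<in> V"
  using dual_chains_carrier by (simp add: twist_def)

lemma polyB_twist:
  "polyB (lin_factor l ^ t) (twist e f a) =
     polyB (lin_factor l ^ t) e + complex_of_real a \<cdot>\<^sub>v J (polyB (lin_factor l ^ t) f)"
  using dual_chains_carrier polyB_cnj_J[of f "lin_factor l ^ t"]
  by (simp add: twist_def polyB_vec_add polyB_vec_smult cnj_lin_factor_power)

lemma twist_annihilated: "polyB (lin_factor l ^ Suc k) (twist e f a) = 0\<^sub>v d"
  using dual unfolding polyB_twist dual_chains_def by simp

lemma K_mult_twist: "K *\<^sub>v twist e f a = \<i> \<cdot>\<^sub>v twist e f (- a)"
proof -
  have "K *\<^sub>v e = \<i> \<cdot>\<^sub>v e" "K *\<^sub>v f = \<i> \<cdot>\<^sub>v f"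
    using dual K_eigenspaceD(2) by (auto simp: dual_chains_def)
  thus ?thesis using dual_chains_carrier
    by (auto simp: twist_def mult_add_distrib_mat_vec[OF K_carrier] mult_mat_vec[OF K_carrier] K_J
        quat_conj_smult algebra_simps intro!: eq_vecI dest: carrier_vecD)
qed

lemma h_twist:
  "h (twist e f a) (polyB (lin_factor l ^ t) (twist e f b)) =
     (if t = k then - complex_of_real (a + b) else 0)"
proof -
  let ?e = "polyB (lin_factor l ^ t) e" and ?f = "polyB (lin_factor l ^ t) f"
  have K: "e \<in> K_eigenspace" "f \<in> K_eigenspace" using dual by (auto simp: dual_chains_def)
  have ef: "\<omega> e ?f = (if t = k then 1 else 0)" using dual by (simp add: dual_chains_def)
  have isotropic: "h e ?e = 0" "h (J f) (J ?f) = 0"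
    using K K_eigenspace_polyB dual_chains_carrier by (simp_all add: K_eigenspace_isotropic h_J_J)
  have "h (J f) ?e = - \<omega> ?e f" using \<omega>_skew[of f ?e] dual_chains_carrier by (simp add: \<omega>_def)
  also have "\<dots> = - \<omega> e ?f" using dual_chains_carrier by (simp add: \<omega>_polyB_left)
  finally have fe: "h (J f) ?e = - \<omega> e ?f" .
  have "h e (J ?f) = cnj (\<omega> ?f e)" using dual_chains_carrier by (simp add: \<omega>_def cnj_h)
  also have "\<omega> ?f e = - \<omega> e ?f" using dual_chains_carrier by (intro \<omega>_skew) simp_all
  finally have ef': "h e (J ?f) = - cnj (\<omega> e ?f)" by simp
  show ?thesis using dual_chains_carrier unfolding polyB_twist unfolding twist_def
    by (simp add: h_add_left h_add_right h_smult_left h_smult_right isotropic fe ef' ef)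
qed

lemma \<omega>_twist: "\<omega> (twist e f a) (polyB (lin_factor l ^ t) (twist e f b)) = 0"
proof -
  let ?e = "polyB (lin_factor l ^ t) e" and ?f = "polyB (lin_factor l ^ t) f"
  have K: "e \<in> K_eigenspace" "f \<in> K_eigenspace" using dual by (auto simp: dual_chains_def)
  have isotropic: "h f ?e = 0" "h (J e) (J ?f) = 0"
    using K K_eigenspace_polyB dual_chains_carrier by (simp_all add: K_eigenspace_isotropic h_J_J)
  have "h f (J ?f) = cnj (\<omega> ?f f)" using dual_chains_carrier by (simp add: \<omega>_def cnj_h)
  also have "\<omega> ?f f = 0" using dual_chains_carrier by (simp add: \<omega>_polyB_left \<omega>_polyB_self)
  finally have "h f (J ?f) = 0" by simp
  moreover have "J (twist e f a) = J e + complex_of_real (- a) \<cdot>\<^sub>v f"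
    using dual_chains_carrier
    by (simp add: twist_def quat_conj_add quat_conj_smult quat_conj_quat_conj smult_smult_assoc)
  moreover have "h (J e) ?e = 0" using dual_chains_carrier \<omega>_polyB_self[of e] by (simp add: \<omega>_def)
  ultimately show ?thesis using dual_chains_carrier unfolding polyB_twist \<omega>_def
    by (simp add: h_add_left h_add_right h_smult_left h_smult_right isotropic)
qed

lemma gram_twist_chain:
  "gram (chain l k (twist e f a)) (chain l k (twist e f b)) = - complex_of_real (a + b) \<cdot>\<^sub>m Q_mat (Suc k)"
  by (rule gram_chain) (simp_all add: h_twist)

lemma gram_J_twist_chain:
  "gram (JM (chain l k (twist e f a))) (chain l k (twist e f b)) = 0\<^sub>m (Suc k) (Suc k)"
  unfolding JM_chain[OF twist_carrier] using \<omega>_twist[unfolded \<omega>_def]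
  by (subst gram_chain[where c = 0]) (auto intro!: eq_matI)

end

text \<open>The condition on \<open>K\<close> makes the orthogonal complement of a frame invariant under \<open>K\<close>.\<close>

definition frame :: "(nat \<times> real) list \<Rightarrow> complex mat \<Rightarrow> bool" where
  "frame ps U \<longleftrightarrow> (\<forall>(k, l) \<in> set ps. k \<ge> 1 \<and> eigenvalue B (complex_of_real l)) \<and>
     U \<in> carrier_mat d (model_size ps) \<and> B * U = U * jordan_model ps \<and> K * U = U * K_model ps \<and>
     gram U U = sip_model ps \<and> gram (JM U) U = 0\<^sub>m (model_size ps) (model_size ps)"

lemma frame_Nil: "frame [] (0\<^sub>m d 0)"
  by (auto simp: frame_def model_Nil K_model_def intro!: eq_matI)

lemma frame_dual_chains:
  assumes dual: "dual_chains l k e f" and l: "eigenvalue B (complex_of_real l)"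
  shows "frame [(Suc k, l)] (hcat (chain l k (twist e f (- 1 / 2))) (chain l k (twist e f (1 / 2))))"
proof -
  define E where "E a = chain l k (twist e f a)" for a
  let ?a = "- 1 / 2 :: real" and ?b = "1 / 2 :: real"
  let ?U = "hcat (E ?a) (E ?b)" and ?n = "Suc k" and ?J = "jordan_block (Suc k) (complex_of_real l)"
  have V [simp]: "twist e f a \<in> V" for a by (rule twist_carrier[OF dual])
  have E: "E a \<in> carrier_mat d ?n" for a by (simp add: E_def)
  have U: "?U \<in> carrier_mat d (?n + ?n)" by (rule hcat_carrier[OF E E])
  note gram_E = gram_twist_chain[OF dual, folded E_def]
    and gram_JE = gram_J_twist_chain[OF dual, folded E_def]
  have "B * ?U = ?U * block_diag ?J ?J"
  proof -
    have "B * E a = E a * ?J" for a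
      unfolding E_def by (rule B_mult_chain[OF V twist_annihilated[OF dual]])
    thus ?thesis
      by (simp add: mult_hcat[OF B_carrier E E]
          hcat_mult_block_diag[OF E E jordan_block_carrier jordan_block_carrier])
  qed
  moreover have "K * ?U = ?U * (\<i> \<cdot>\<^sub>m swap_mat ?n)"
  proof -
    have "K * E a = \<i> \<cdot>\<^sub>m E (- a)" for a
      unfolding E_def by (rule K_mult_chain) (simp_all add: K_mult_twist[OF dual])
    hence "K * ?U = \<i> \<cdot>\<^sub>m hcat (E ?b) (E ?a)"
      unfolding mult_hcat[OF K_carrier E E] using carrier_matD[OF E] by (simp add: smult_hcat)
    thus ?thesis using U by (simp add: mult_smult_mat hcat_mult_swap_mat[OF E E])
  qed
  moreover have "gram ?U ?U = block_diag (Q_mat ?n) (- Q_mat ?n)"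
    unfolding gram_hcat[OF E E E E] gram_E block_diag_def
    by (intro cong_four_block_mat) (auto intro!: eq_matI)
  moreover have "gram (JM ?U) ?U = 0\<^sub>m (?n + ?n) (?n + ?n)"
  proof -
    have JE: "JM (E a) \<in> carrier_mat d ?n" for a using E[of a] by auto
    show ?thesis unfolding quat_conj_mat_hcat[OF E E] gram_hcat[OF JE JE E E] gram_JE by simp
  qed
  ultimately show ?thesis using l U by (simp add: frame_def model_singleton K_model_def E_def)
qed

lemma frame_append:
  assumes F: "frame ps U" and F': "frame qs U'"
    and perp: "\<And>j. j < model_size qs \<Longrightarrow> col U' j \<in> orth (quat_completion N U)"
  shows "frame (ps @ qs) (hcat U U')"
proof -
  let ?n = "model_size ps" and ?n' = "model_size qs"
  have U: "U \<in> carrier_mat d ?n" and U': "U' \<in> carrier_mat d ?n'" using F F' by (auto simp: frame_def)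
  have J: "JM U \<in> carrier_mat d ?n" "JM U' \<in> carrier_mat d ?n'" using U U' by auto
  have UU': "gram U U' = 0\<^sub>m ?n ?n'" "gram (JM U) U' = 0\<^sub>m ?n ?n'"
    using perp by (simp_all add: gram_eq_0_of_orth[OF U U'])
  have U'U: "gram U' U = 0\<^sub>m ?n' ?n" "gram (JM U') U = 0\<^sub>m ?n' ?n"
  proof -
    have "gram U' U = mat_adjoint (gram U U')" using U U' by (simp add: mat_adjoint_gram)
    thus "gram U' U = 0\<^sub>m ?n' ?n" unfolding UU' by (auto intro!: eq_matI)
    show "gram (JM U') U = 0\<^sub>m ?n' ?n" unfolding gram_JM_skew[OF U' U] UU' by (auto intro!: eq_matI)
  qed
  have models: "K_model qs' \<in> carrier_mat (model_size qs') (model_size qs')" for qs'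
    by (simp add: K_model_def)
  have "B * hcat U U' = hcat U U' * block_diag (jordan_model ps) (jordan_model qs)"
    using F F' unfolding mult_hcat[OF B_carrier U U'] frame_def
    by (simp add: hcat_mult_block_diag[OF U U' model_carrier(1) model_carrier(1)])
  moreover have "K * hcat U U' = hcat U U' * block_diag (K_model ps) (K_model qs)"
    using F F' unfolding mult_hcat[OF K_carrier U U'] frame_def
    by (simp add: hcat_mult_block_diag[OF U U' models models])
  moreover have "gram (hcat U U') (hcat U U') = block_diag (sip_model ps) (sip_model qs)"
    using F F' unfolding gram_hcat[OF U U' U U'] frame_def by (simp add: UU' U'U block_diag_def)
  moreover have "gram (JM (hcat U U')) (hcat U U') = 0\<^sub>m (?n + ?n') (?n + ?n')"
    using F F' unfolding quat_conj_mat_hcat[OF U U'] gram_hcat[OF J U U'] frame_def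
    by (simp add: UU' U'U)
  ultimately show ?thesis
    using F F' hcat_carrier[OF U U'] unfolding frame_def
    by (auto simp: model_append K_model_def smult_block_diag)
qed

lemma frame_quat_completion:
  assumes F: "frame ps U"
  defines "S \<equiv> quat_completion N U"
  shows "S \<in> carrier_mat d (model_size ps + model_size ps)"
    and "B * S = S * block_diag (jordan_model ps) (jordan_model ps)"
    and "K * S = S * block_diag (K_model ps) (map_mat cnj (K_model ps))"
    and "gram S S = block_diag (sip_model ps) (sip_model ps)"
    and "block_diag (sip_model ps) (sip_model ps) * block_diag (sip_model ps) (sip_model ps) =
      1\<^sub>m (model_size ps + model_size ps)"
proof -
  have U: "U \<in> carrier_mat d (model_size ps)" using F by (simp add: frame_def)
  show "S \<in> carrier_mat d (model_size ps + model_size ps)"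
    unfolding S_def by (rule quat_completion_carrier[OF U])
  show "B * S = S * block_diag (jordan_model ps) (jordan_model ps)"
    using F B_sa Omega_mult_quat_completion[of B N U "model_size ps" "jordan_model ps"]
    by (simp add: S_def frame_def quat_selfadjoint_def cnj_jordan_model)
  show "K * S = S * block_diag (K_model ps) (map_mat cnj (K_model ps))"
    using F K_sa
    by (auto simp: S_def frame_def quat_selfadjoint_def K_model_def intro!: Omega_mult_quat_completion)
  show "gram S S = block_diag (sip_model ps) (sip_model ps)"
    using F gram_quat_completion[OF U, of "sip_model ps"] by (simp add: S_def frame_def cnj_sip_model)
  show "block_diag (sip_model ps) (sip_model ps) * block_diag (sip_model ps) (sip_model ps) =
      1\<^sub>m (model_size ps + model_size ps)"
    by (simp add: block_diag_mult sip_model_square block_diag_one)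
qed

lemma frame_orth_invariant:
  assumes F: "frame ps U"
  shows "invariant (orth (quat_completion N U))"
proof -
  let ?S = "quat_completion N U"
  have U: "U \<in> carrier_mat d (model_size ps)" using F by (simp add: frame_def)
  note S = frame_quat_completion[OF F]
  have dim: "dim_row ?S = d" using S(1) by simp
  show ?thesis unfolding invariant_def
  proof (intro conjI ballI allI)
    show "orth ?S \<subseteq> V" using orth_carrier by blast
    fix x assume x: "x \<in> orth ?S"
    show "a \<cdot>\<^sub>v x \<in> orth ?S" for a by (rule orth_closed_smult[OF x dim])
    show "x + y \<in> orth ?S" if "y \<in> orth ?S" for y by (rule orth_closed_add[OF x that dim])
    show "B *\<^sub>v x \<in> orth ?S" by (rule orth_closed_selfadjoint[OF B_sa S(1) _ S(2) x]) simp
    show "K *\<^sub>v x \<in> orth ?S"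
      by (rule orth_closed_selfadjoint[OF K_sa S(1) _ S(3) x]) (simp add: K_model_def)
    show "J x \<in> orth ?S"
      by (rule orth_closed_J[OF S(1) quat_mat_carrier quat_conj_mat_quat_completion[OF U] x])
  qed
qed

lemma H_injective:
  assumes "x \<in> V" and "H *\<^sub>v x = 0\<^sub>v d"
  shows "x = 0\<^sub>v d"
proof -
  note inverse = inv_mat_inverse[OF H_carrier H_invertible]
  have "inv_mat H * H *\<^sub>v x = inv_mat H *\<^sub>v (H *\<^sub>v x)"
    by (rule assoc_mult_mat_vec[OF inverse(1) H_carrier assms(1)])
  thus ?thesis using assms carrier_matD[OF inverse(1)] by (simp add: inverse(3))
qed

lemma frame_orth_nondegenerate:
  assumes F: "frame ps U"
  shows "nondegenerate (orth (quat_completion N U))"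
  unfolding nondegenerate_def
proof (intro ballI impI)
  fix x assume x: "x \<in> orth (quat_completion N U)" and "\<forall>y \<in> orth (quat_completion N U). h x y = 0"
  hence "H *\<^sub>v x = 0\<^sub>v d"
    using orth_radical[OF frame_quat_completion(1,4,5)[OF F]] by blast
  thus "x = 0\<^sub>v d" by (rule H_injective[OF orth_carrier[OF x]])
qed

lemma frame_extend:
  assumes F: "frame ps U" and x: "x \<in> orth (quat_completion N U)" "x \<noteq> 0\<^sub>v d"
  shows "\<exists>qs U'. frame qs U' \<and> model_size ps < model_size qs"
proof -
  let ?W = "orth (quat_completion N U)"
  note W = frame_orth_invariant[OF F] frame_orth_nondegenerate[OF F]
  obtain l k e f where l: "eigenvalue B (complex_of_real l)" and e: "e \<in> ?W" and f: "f \<in> ?W"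
    and dual: "dual_chains l k e f"
    using ex_dual_chains[OF W x] by metis
  have "twist e f a \<in> ?W" for a using invariantD[OF W(1)] e f by (simp add: twist_def)
  hence "col (hcat (chain l k (twist e f (- 1 / 2))) (chain l k (twist e f (1 / 2)))) j \<in> ?W"
    if "j < model_size [(Suc k, l)]" for j
    using that by (simp add: col_hcat[OF chain_carrier chain_carrier] col_chain
        invariant_polyB[OF W(1)] model_singleton)
  from frame_append[OF F frame_dual_chains[OF dual l] this]
  show ?thesis using model_append(4)[of ps "[(Suc k, l)]"] by (auto simp: model_singleton)
qed

lemma frame_size_le:
  assumes F: "frame ps U"
  shows "model_size ps + model_size ps \<le> d"
proof -
  note S = frame_quat_completion[OF F]
  show ?thesis
    by (rule left_invertible_mat_dim_le[OF S(1) coefficients_carrier[OF S(1,4,5)]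
        coefficients_left_inverse[OF S(1,4,5)]])
qed

lemma ex_complete_frame: "\<exists>ps U. frame ps U \<and> orth (quat_completion N U) \<subseteq> {0\<^sub>v d}"
proof -
  define P where "P r \<longleftrightarrow> (\<exists>ps U. frame ps U \<and> model_size ps = r)" for r
  have "P 0" using frame_Nil by (auto simp: P_def model_Nil)
  moreover have "r \<le> d" if "P r" for r using that frame_size_le by (fastforce simp: P_def)
  ultimately obtain r where "P r" and maximal: "\<And>r'. P r' \<Longrightarrow> r' \<le> r"
    using Nat.ex_has_greatest_nat[of P 0 d] by blast
  then obtain ps U where F: "frame ps U" "model_size ps = r" by (auto simp: P_def)
  have "x = 0\<^sub>v d" if x: "x \<in> orth (quat_completion N U)" for x
  proof (rule ccontr)
    assume "x \<noteq> 0\<^sub>v d"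
    then obtain qs U' where "frame qs U'" "r < model_size qs"
      using frame_extend[OF F(1) x] F(2) by blast
    thus False using maximal[of "model_size qs"] by (auto simp: P_def)
  qed
  thus ?thesis using F(1) by blast
qed

theorem canonical_form:
  "\<exists>S \<in> Omega N. \<exists>ps. invertible_mat S \<and> (\<forall>(k, l) \<in> set ps. k \<ge> 1 \<and> eigenvalue B (complex_of_real l)) \<and>
     inv_mat S * B * S = block_diag (jordan_model ps) (jordan_model ps) \<and>
     mat_adjoint S * H * S = block_diag (sip_model ps) (sip_model ps)"
proof -
  obtain ps U where F: "frame ps U" and complete: "orth (quat_completion N U) \<subseteq> {0\<^sub>v d}"
    using ex_complete_frame by blast
  define S where "S = quat_completion N U"
  let ?n = "model_size ps" and ?D = "block_diag (jordan_model ps) (jordan_model ps)"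
  define X where "X = coefficients S (block_diag (sip_model ps) (sip_model ps))"
  note S = frame_quat_completion[OF F, folded S_def]
  have X: "X \<in> carrier_mat (?n + ?n) d" and XS: "X * S = 1\<^sub>m (?n + ?n)" and SX: "S * X = 1\<^sub>m d"
    unfolding X_def using coefficients_carrier[OF S(1,4,5)]
        coefficients_left_inverse[OF S(1,4,5)]
      coefficients_right_inverse[OF S(1,4,5)] complete by (simp_all add: S_def)
  have n: "?n = N"
    using frame_size_le[OF F] left_invertible_mat_dim_le[OF X S(1) SX] by simp
  have "square_mat S" "inverts_mat S X" "inverts_mat X S"
    using carrier_matD[OF S(1)] carrier_matD[OF X]
    by (simp_all only: square_mat.simps inverts_mat_def XS SX n)
  hence invertible: "invertible_mat S" unfolding invertible_mat_def by blast
  note carriers = S(1)[unfolded n]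
      block_diag_carrier[OF model_carrier(1) model_carrier(1), of ps ps, unfolded n]
  note inverse = inv_mat_inverse[OF carriers(1) invertible]
  have "inv_mat S * B * S = inv_mat S * S * ?D"
    using inverse(1) carriers S(2) by (simp add: mult_mat_assoc n)
  hence "inv_mat S * B * S = ?D" unfolding inverse(3) left_mult_one_mat[OF carriers(2)] .
  moreover have "S \<in> Omega N"
    using F quat_completion_Omega[of U N] by (simp add: S_def frame_def n)
  moreover have "\<forall>(k, l) \<in> set ps. k \<ge> 1 \<and> eigenvalue B (complex_of_real l)"
    using F by (simp add: frame_def)
  ultimately show ?thesis using invertible S(4) unfolding gram_def by blast
qed

end

lemma complex_structure_of_canonical_form:
  assumes S: "S \<in> Omega N" "invertible_mat S"
    and H: "H \<in> carrier_mat (N + N) (N + N)" and B: "B \<in> carrier_mat (N + N) (N + N)"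
    and D: "inv_mat S * B * S = block_diag (jordan_model ps) (jordan_model ps)"
    and Q: "mat_adjoint S * H * S = block_diag (sip_model ps) (sip_model ps)"
  shows "\<exists>K. complex_structure N H B K"
proof -
  note cS = Omega_carrier[OF S(1)]
  note inverse = inv_mat_inverse[OF cS S(2)]
  have "N + N = model_size ps + model_size ps"
    using arg_cong[OF Q, of dim_row] carrier_matD[OF cS] by simp
  hence N: "model_size ps = N" by simp
  show ?thesis
    using complex_structure_congruence[OF S(1) inverse H B, unfolded D Q]
      complex_structure_model[of ps, unfolded N] by blast
qed

theorem mainTheorem8:
  fixes m n :: nat and Ht Bt :: "complex mat"
  assumes "even m" and "m > 0"
    and "Ht \<in> Omega (2 * n)" and "invertible_mat Ht" and "hermitian_mat Ht"
    and "Bt \<in> Omega (2 * n)" and "H_selfadjoint Ht Bt"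
    and "spectrum_mat Bt \<subseteq> complex_of_real ` {x. x < 0}"
  shows "(\<exists>At \<in> Omega (2 * n). H_selfadjoint Ht At \<and> At ^\<^sub>m m = Bt) \<longleftrightarrow>
         (\<exists>S \<in> Omega (2 * n). \<exists>ps :: (nat \<times> real) list.
            invertible_mat S \<and> (\<forall>(k, l) \<in> set ps. k \<ge> 1 \<and> l < 0) \<and>
            inv_mat S * Bt * S = diag_block_mat (jordan_part ps @ jordan_part ps) \<and>
            mat_adjoint S * Ht * S = diag_block_mat (Q_part ps @ Q_part ps))" (is "?root \<longleftrightarrow> ?canonical")
proof
  let ?N = "2 * n"
  note carriers = Omega_carrier[OF assms(3)] Omega_carrier[OF assms(6)]
  have B_sa: "quat_selfadjoint ?N Ht Bt" using assms(6,7) by (simp add: quat_selfadjoint_def)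
  have negative: "l < 0" if "eigenvalue Bt (complex_of_real l)" for l
    using that assms(8) by (auto simp: spectrum_mat_def)
  note models = diag_block_mat_append_eq jordan_model_def[symmetric] sip_model_def[symmetric]
  {
    assume ?root
    then obtain K where "complex_structure ?N Ht Bt K"
      using complex_structure_of_even_root[OF carriers(1)] assms(1,8) unfolding quat_selfadjoint_def
      by blast
    then interpret quat_complex_structure ?N Ht Bt K
      using assms B_sa by unfold_locales auto
    show ?canonical using canonical_form negative unfolding models by fast
  next
    assume ?canonical
    then obtain K where "complex_structure ?N Ht Bt K"
      using complex_structure_of_canonical_form[OF _ _ carriers] unfolding models by blast
    thus ?root
      using root_of_complex_structure[OF carriers(1) B_sa _ assms(2,8)]
      by (auto simp: quat_selfadjoint_def)
  }
qed

end
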